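(* Let $m\ge1$ be an integer, let $q_c=\frac{m+2+\sqrt{m(m+4)}}{2}$, and for $q>1$ set $$c_1:=\frac{\log m}{\log q},\quad c_2:=\frac{\log (m+1)}{\log q}.$$ (i) If $q\in [q_c,\infty)$, then $\mathcal D_{m,m}(q)$ contains the interval $[c_1,c_2]$. (ii) If $q\in (m+1,q_c)$, then there exists a $\delta>0$ such that $\mathcal D_{m,m}(q)\cap(c_2-\delta,c_2)=\varnothing$.
   Context: For a real number $q>1$ and a finite set $\Omega$ of real numbers, a sequence $(c_i)_{i=1}^\infty\in\Omega^{\mathbb N}$ is an expansion of $x$ in base $q$ over the alphabet $\Omega$ if $\sum_{i=1}^\infty c_iq^{-i}=x$. For a positive integer $m$ put $\Gamma_{q,m}=\{\sum_{i=1}^\infty c_iq^{-i} : c_i\in\{0,1,\ldots,m\}\}$. $\mathcal U_{m,m}(q)$ denotes the set of real numbers $t$ having a unique expansion in base $q$ over the alphabet $\{-m,\ldots,-1,0,1,\ldots,m\}$, and $$\mathcal D_{m,m}(q)=\{\dim_H(\Gamma_{q,m}\cap(\Gamma_{q,m}+t)) : t\in\mathcal U_{m,m}(q)\},$$ where $\dim_H$ is Hausdorff dimension. The number $q_c$ is the positive solution of $\frac{m+1}{q_c}+\sum_{i=2}^\infty\frac{m}{q_c^i}=1$. *)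

theory Defs
  imports "HOL-Analysis.Analysis"
begin

text \<open>
  Hausdorff measure and dimension of subsets of a metric space. Only bounded sets are admitted in
  covers, because \<open>diameter\<close> is real-valued and has an unspecified value on unbounded sets. As usual
  \<open>0\<^sup>0 = 1\<close> for the diameter of a nonempty set (whereas \<open>0 powr 0 = 0\<close>), and empty sets in a
  cover contribute \<open>0\<close> for every exponent.
\<close>

definition diam_pow :: "real \<Rightarrow> 'a::metric_space set \<Rightarrow> ennreal" where
  "diam_pow s U = (if U = {} then 0 else if s = 0 then 1 else ennreal (diameter U powr s))"

definition hausdorff_content :: "real \<Rightarrow> real \<Rightarrow> 'a::metric_space set \<Rightarrow> ennreal" where
  "hausdorff_content s \<delta> A =
     (INF U \<in> {U :: nat \<Rightarrow> 'a set. A \<subseteq> (\<Union>i. U i) \<and> (\<forall>i. bounded (U i) \<and> diameter (U i) \<le> \<delta>)}.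
        \<Sum>i. diam_pow s (U i))"

definition hausdorff_measure :: "real \<Rightarrow> 'a::metric_space set \<Rightarrow> ennreal" where
  "hausdorff_measure s A = (SUP \<delta>\<in>{0<..}. hausdorff_content s \<delta> A)"

definition hausdorff_dim :: "'a::metric_space set \<Rightarrow> ereal" where
  "hausdorff_dim A = Inf (ereal ` {s. 0 \<le> s \<and> hausdorff_measure s A = 0})"

text \<open>Digit sequences are indexed from \<open>0\<close>, so \<open>c i\<close> is the digit of weight \<open>1 / q ^ (i + 1)\<close>.\<close>

definition is_expansion :: "real \<Rightarrow> real set \<Rightarrow> (nat \<Rightarrow> real) \<Rightarrow> real \<Rightarrow> bool" where
  "is_expansion q \<Omega> c x \<longleftrightarrow> (\<forall>i. c i \<in> \<Omega>) \<and> (\<lambda>i. c i / q ^ Suc i) sums x"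

definition Gamma_set :: "real \<Rightarrow> nat \<Rightarrow> real set" where
  "Gamma_set q m = {x. \<exists>c. is_expansion q (real ` {0..m}) c x}"

definition unique_exp_set :: "nat \<Rightarrow> real \<Rightarrow> real set" where
  "unique_exp_set m q = {t. \<exists>!c. is_expansion q (real_of_int ` {- int m..int m}) c t}"

definition dim_set :: "nat \<Rightarrow> real \<Rightarrow> ereal set" where
  "dim_set m q =
     {hausdorff_dim (Gamma_set q m \<inter> (\<lambda>x. x + t) ` Gamma_set q m) | t. t \<in> unique_exp_set m q}"

definition q_crit :: "nat \<Rightarrow> real" where
  "q_crit m = (real m + 2 + sqrt (real m * (real m + 4))) / 2"

lemma q_crit_iff:
  fixes m :: nat and q :: real
  assumes "m \<ge> 1" "q > 1"
  shows "(real m + 1) / q + (\<Sum>i. real m / q ^ (i + 2)) = 1 \<longleftrightarrow> q = q_crit m"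
proof -
  define M where "M = real m"
  define r where "r = sqrt (M * (M + 4))"
  have M: "M \<ge> 1" using assms by (simp add: M_def)
  have r2: "r\<^sup>2 = M * (M + 4)" using M by (simp add: r_def)
  have rM: "r \<ge> M" unfolding r_def
    by (rule real_le_rsqrt) (use M in \<open>simp add: power2_eq_square\<close>)
  have "(\<lambda>i. M / q\<^sup>2 * (1 / q) ^ i) sums (M / q\<^sup>2 * (1 / (1 - 1 / q)))"
    by (rule sums_mult, rule geometric_sums) (use assms in auto)
  then have "(\<lambda>i. M / q ^ (i + 2)) sums (M / q\<^sup>2 * (1 / (1 - 1 / q)))"
    by (simp add: power_divide power_add mult_ac power2_eq_square)
  then have "(\<Sum>i. M / q ^ (i + 2)) = M / q\<^sup>2 * (1 / (1 - 1 / q))"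
    by (rule sums_unique[symmetric])
  also have "\<dots> = M / (q * (q - 1))"
    using assms by (simp add: field_simps power2_eq_square)
  finally have s: "(\<Sum>i. M / q ^ (i + 2)) = M / (q * (q - 1))" .
  have "(M + 1) / q + M / (q * (q - 1)) = 1 \<longleftrightarrow> (M + 1) * (q - 1) + M = q * (q - 1)"
  proof -
    have "(M + 1) / q + M / (q * (q - 1)) = ((M + 1) * (q - 1) + M) / (q * (q - 1))"
      using assms by (simp add: add_divide_distrib)
    then show ?thesis using assms by (simp add: divide_eq_eq)
  qed
  also have "\<dots> \<longleftrightarrow> (2 * q - (M + 2))\<^sup>2 = r\<^sup>2"
    unfolding r2 by (auto simp: power2_eq_square algebra_simps)
  also have "\<dots> \<longleftrightarrow> 2 * q - (M + 2) = r \<or> 2 * q - (M + 2) = - r"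
    by (rule power2_eq_iff)
  also have "\<dots> \<longleftrightarrow> q = (M + 2 + r) / 2"
    using assms rM by auto
  finally show ?thesis
    using s by (simp add: q_crit_def M_def r_def)
qed

end

theory Submission
  imports Defs
begin

text \<open>
  If \<open>t\<close> has the unique expansion \<open>\<tau>\<close>, then \<open>\<Gamma> \<inter> (\<Gamma> + t)\<close> consists of the sums whose \<open>i\<close>-th digit
  ranges over \<open>m + 1 - \<bar>\<tau> i\<bar>\<close> consecutive integers. As \<open>q > m + 1\<close>, its cylinders are well separated, and
  its dimension is governed by the growth of \<open>\<Prod>i<n. m + 1 - \<bar>\<tau> i\<bar>\<close> against powers of \<open>q\<close>.

  For \<open>q \<ge> q_crit m\<close>, every sequence over \<open>{-1, 0, 1}\<close> whose nonzero digits alternate in sign and occur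
  infinitely often is a unique expansion, and the frequency of the nonzero digits may be prescribed
  by taking \<open>\<tau> i = p (i + 1) - p i\<close> where \<open>p i\<close> is the parity of \<open>\<lfloor>i \<alpha>\<rfloor>\<close>
  (the zero sequence for \<open>\<alpha> = 0\<close>). For \<open>m + 1 < q < q_crit m\<close> all
  numbers of modulus at most \<open>m / (q - 1)\<close> have expansions, which forces every nonzero digit of a
  unique expansion that comes after some zero to be followed by another one within bounded distance.
  So a unique expansion either ends in zeros (dimension \<open>c\<^sub>2\<close>) or has nonzero digits
  of lower frequency bounded away from \<open>0\<close> uniformly in \<open>t\<close>.
\<close>

subsection \<open>Bounds for the Hausdorff dimension\<close>

text \<open>Carries a lower bound for the sums at exponent \<open>s\<close> down to every smaller
  \<open>u\<close>. The case \<open>u = 0\<close> is separate because \<open>diam_pow\<close> is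
  then 1 even at diameter 0, while \<open>0 powr 0 = 0\<close>.\<close>

lemma diam_pow_antimono:
  assumes "0 \<le> u" "u \<le> s" "bounded U" "diameter U \<le> 1"
  shows "diam_pow s U \<le> diam_pow u U"
proof -
  have d: "0 \<le> diameter U" by (rule diameter_ge_0) fact
  show ?thesis
  proof (cases "u = 0")
    case True
    then show ?thesis
      using assms d by (auto simp: diam_pow_def ennreal_le_1 intro: powr_le1)
  next
    case False
    then show ?thesis
      using assms d by (auto simp: diam_pow_def intro!: ennreal_leI powr_mono')
  qed
qed

text \<open>A mass distribution argument: \<open>h\<close> carries Lebesgue measure on \<open>[0, 1)\<close> to \<open>A\<close>.\<close>

lemma hausdorff_dim_ge:
  fixes h :: "real \<Rightarrow> 'a::metric_space"
  assumes C: "C > 0" and s: "s > 0" and hA: "\<And>x. x \<in> {0..<1} \<Longrightarrow> h x \<in> A"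
    and hoelder: "\<And>x y. x \<in> {0..<1} \<Longrightarrow> y \<in> {0..<1} \<Longrightarrow> \<bar>x - y\<bar> \<le> C * dist (h x) (h y) powr s"
  shows "ereal s \<le> hausdorff_dim A"
proof -
  have key: "ennreal (1 / (2 * C)) \<le> (\<Sum>i. diam_pow s (U i))"
    if cov: "A \<subseteq> (\<Union>i. U i)" and bdd: "\<And>i. bounded (U i)" for U :: "nat \<Rightarrow> 'a set"
  proof -
    define B where "B i = {y \<in> {0..<1}. h y \<in> U i}" for i
    define d where "d i = C * diameter (U i) powr s" for i
    \<comment> \<open>The preimage \<open>B i\<close> need not be measurable. The Hoelder bound
      confines it to an interval around any of its points, and that interval is measurable.\<close>
    define V where "V i = (if B i = {} then {} else {(SOME y. y \<in> B i) - d i .. (SOME y. y \<in> B i) + d i})" for i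
    have d0: "0 \<le> d i" for i using C by (simp add: d_def)
    have BV: "B i \<subseteq> V i" for i
    proof
      fix y assume y: "y \<in> B i"
      define z where "z = (SOME y. y \<in> B i)"
      have z: "z \<in> B i" unfolding z_def using y by (rule someI)
      have "\<bar>y - z\<bar> \<le> C * dist (h y) (h z) powr s"
        using y z by (intro hoelder) (auto simp: B_def)
      also have "\<dots> \<le> d i"
        unfolding d_def using y z C s bdd[of i]
        by (intro mult_left_mono powr_mono2 diameter_bounded_bound) (auto simp: B_def)
      finally show "y \<in> V i" using y by (auto simp: V_def z_def[symmetric])
    qed
    have emV: "emeasure lborel (V i) \<le> ennreal (2 * C) * diam_pow s (U i)" for i
    proof (cases "B i = {}")
      case False
      then have "U i \<noteq> {}" by (auto simp: B_def)
      then show ?thesis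
        using False d0[of i] C s
        by (auto simp: V_def diam_pow_def d_def ennreal_mult[symmetric] intro!: ennreal_leI)
    qed (simp add: V_def)
    have "{0..<1} \<subseteq> (\<Union>i. V i)"
    proof
      fix y :: real assume "y \<in> {0..<1}"
      then obtain i where "y \<in> B i" using hA[of y] cov by (auto simp: B_def)
      then show "y \<in> (\<Union>i. V i)" using BV by blast
    qed
    then have "emeasure lborel {0..<1::real} \<le> emeasure lborel (\<Union>i. V i)"
      by (intro emeasure_mono) (auto simp: V_def)
    also have "\<dots> \<le> (\<Sum>i. emeasure lborel (V i))"
      by (rule emeasure_subadditive_countably) (auto simp: V_def)
    also have "\<dots> \<le> (\<Sum>i. ennreal (2 * C) * diam_pow s (U i))"
      by (intro suminf_le emV) auto
    also have "\<dots> = ennreal (2 * C) * (\<Sum>i. diam_pow s (U i))" by simp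
    finally have "ennreal (1 / (2 * C)) * 1 \<le> ennreal (1 / (2 * C)) * (ennreal (2 * C) * (\<Sum>i. diam_pow s (U i)))"
      by (intro mult_left_mono) auto
    also have "\<dots> = (\<Sum>i. diam_pow s (U i))"
      using C by (simp add: mult.assoc[symmetric] ennreal_mult[symmetric])
    finally show ?thesis by simp
  qed
  have "s \<le> u" if u: "0 \<le> u" "hausdorff_measure u A = 0" for u
  proof (rule ccontr)
    \<comment> \<open>Scale 1 is fine enough: \<open>key\<close> holds for all bounded covers, and
      diameters at most 1 allow the exponent to drop from \<open>s\<close> to
      \<open>u\<close>.\<close>
    assume "\<not> s \<le> u"
    have "ennreal (1 / (2 * C)) \<le> hausdorff_content u 1 A"
      unfolding hausdorff_content_def
    proof (rule INF_greatest)
      fix U :: "nat \<Rightarrow> 'a set"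
      assume U: "U \<in> {U. A \<subseteq> (\<Union>i. U i) \<and> (\<forall>i. bounded (U i) \<and> diameter (U i) \<le> 1)}"
      have "ennreal (1 / (2 * C)) \<le> (\<Sum>i. diam_pow s (U i))"
        using U by (intro key) auto
      also have "\<dots> \<le> (\<Sum>i. diam_pow u (U i))"
        using U u \<open>\<not> s \<le> u\<close> by (intro suminf_le diam_pow_antimono) auto
      finally show "ennreal (1 / (2 * C)) \<le> (\<Sum>i. diam_pow u (U i))" .
    qed
    also have "\<dots> \<le> hausdorff_measure u A"
      unfolding hausdorff_measure_def by (rule SUP_upper) simp
    finally show False using u C by simp
  qed
  then show ?thesis
    unfolding hausdorff_dim_def by (intro Inf_greatest) auto
qed

lemma hausdorff_content_le_card:
  fixes A :: "real set"
  assumes F: "finite F" "A \<subseteq> (\<Union>x\<in>F. {x..x + d})" and d: "0 < d" "d \<le> \<delta>" and u: "0 < u"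
  shows "hausdorff_content u \<delta> A \<le> ennreal (real (card F) * d powr u)"
proof -
  obtain f where f: "bij_betw f {0..<card F} F"
    using ex_bij_betw_nat_finite[OF F(1)] by blast
  \<comment> \<open>The finite cover is padded with empty sets, which cost 0 in
    \<open>diam_pow\<close>.\<close>
  define U where "U i = (if i < card F then {f i..f i + d} else {})" for i :: nat
  have "A \<subseteq> (\<Union>i. U i)"
  proof
    fix a assume "a \<in> A"
    then obtain x where x: "x \<in> F" "a \<in> {x..x + d}" using F by blast
    then obtain i where "i < card F" "f i = x"
      using bij_betw_imp_surj_on[OF f] by (metis atLeastLessThan_iff imageE)
    then have "a \<in> U i" using x by (simp add: U_def)
    then show "a \<in> (\<Union>i. U i)" by blast
  qed
  moreover have "bounded (U i) \<and> diameter (U i) \<le> \<delta>" for i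
    using d by (simp add: U_def)
  ultimately have "hausdorff_content u \<delta> A \<le> (\<Sum>i. diam_pow u (U i))"
    unfolding hausdorff_content_def by (intro INF_lower) auto
  also have "\<dots> = (\<Sum>i<card F. diam_pow u (U i))"
    by (rule suminf_finite) (auto simp: U_def diam_pow_def)
  also have "\<dots> = (\<Sum>i<card F. ennreal (d powr u))"
    using d u by (intro sum.cong) (auto simp: U_def diam_pow_def)
  also have "\<dots> = ennreal (real (card F) * d powr u)"
    by (simp add: ennreal_mult ennreal_of_nat_eq_real_of_nat)
  finally show ?thesis .
qed

text \<open>At exponent \<open>s + e\<close> the cover of scale \<open>1 / q ^ n\<close> costs at
  most \<open>C * q powr (- n * e)\<close>, which tends to 0. Each content is an infimum, so
  infinitely many \<open>n\<close> suffice.\<close>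

lemma hausdorff_dim_le:
  fixes A :: "real set"
  assumes q: "q > 1" and s: "0 \<le> s"
    and cov: "\<exists>\<^sub>F n in sequentially. \<exists>F. finite F \<and> real (card F) \<le> C * q powr (real n * s) \<and>
                A \<subseteq> (\<Union>x\<in>F. {x..x + 1 / q ^ n})"
  shows "hausdorff_dim A \<le> ereal s"
proof (rule ereal_le_epsilon2)
  fix e :: real assume e: "e > 0"
  define u where "u = s + e"
  have u: "u > 0" using s e by (simp add: u_def)
  have "hausdorff_content u \<delta> A = 0" if \<delta>: "\<delta> > 0" for \<delta>
  proof -
    have "hausdorff_content u \<delta> A \<le> 0 + ennreal \<epsilon>" if \<epsilon>: "\<epsilon> > 0" for \<epsilon>
    proof -
      have "(\<lambda>n. (1 / q) ^ n) \<longlonglongrightarrow> 0" using q by (intro LIMSEQ_power_zero) auto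
      then have ev1: "\<forall>\<^sub>F n in sequentially. (1 / q) ^ n < \<delta>"
        using \<delta> by (rule order_tendstoD)
      have "(\<lambda>n. (q powr (- e)) ^ n) \<longlonglongrightarrow> 0"
        using q e by (intro LIMSEQ_power_zero) (auto simp: powr_minus inverse_less_1_iff)
      then have "(\<lambda>n. C * (q powr (- e)) ^ n) \<longlonglongrightarrow> 0"
        using tendsto_mult_right_zero by blast
      then have ev2: "\<forall>\<^sub>F n in sequentially. C * (q powr (- e)) ^ n < \<epsilon>"
        using \<epsilon> by (rule order_tendstoD)
      from cov have "\<exists>\<^sub>F n in sequentially. (\<exists>F. finite F \<and> real (card F) \<le> C * q powr (real n * s) \<and>
                A \<subseteq> (\<Union>x\<in>F. {x..x + 1 / q ^ n})) \<and> ((1 / q) ^ n < \<delta> \<and> C * (q powr (- e)) ^ n < \<epsilon>)"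
        using eventually_conj[OF ev1 ev2] by (rule frequently_rev_mp[OF _ eventually_mono]) simp
      from frequently_ex[OF this] obtain n F where nF: "finite F" "real (card F) \<le> C * q powr (real n * s)"
        "A \<subseteq> (\<Union>x\<in>F. {x..x + 1 / q ^ n})" "(1 / q) ^ n < \<delta>" "C * (q powr (- e)) ^ n < \<epsilon>"
        by blast
      have qu: "(1 / q ^ n) powr u = q powr (- real n * u)"
      proof -
        have "1 / q ^ n = q powr (- real n)" using q by (simp add: powr_minus_divide powr_realpow)
        then show ?thesis by (simp add: powr_powr)
      qed
      have "real (card F) * (1 / q ^ n) powr u \<le> C * q powr (real n * s) * (1 / q ^ n) powr u"
        using nF by (intro mult_right_mono) auto
      also have "C * q powr (real n * s) * (1 / q ^ n) powr u = C * (q powr (- e)) ^ n"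
        unfolding qu using q by (simp add: powr_power powr_add[symmetric] u_def algebra_simps)
      also have "\<dots> \<le> \<epsilon>" using nF by simp
      finally have "ennreal (real (card F) * (1 / q ^ n) powr u) \<le> ennreal \<epsilon>"
        by (rule ennreal_leI)
      moreover have "hausdorff_content u \<delta> A \<le> ennreal (real (card F) * (1 / q ^ n) powr u)"
        using nF q u by (intro hausdorff_content_le_card) (auto simp: power_divide)
      ultimately show ?thesis by simp
    qed
    then have "hausdorff_content u \<delta> A \<le> 0" by (rule ennreal_le_epsilon)
    then show ?thesis by simp
  qed
  then have "hausdorff_measure u A = 0"
    unfolding hausdorff_measure_def by (simp add: bot_ennreal)
  then show "hausdorff_dim A \<le> ereal s + ereal e"
    unfolding hausdorff_dim_def using u by (intro Inf_lower) (auto simp: u_def)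
qed

subsection \<open>Digit expansions\<close>

lemma geometric_digit_sums:
  fixes q :: real
  assumes "q > 1"
  shows "(\<lambda>i. B / q ^ Suc i) sums (B / (q - 1))"
proof -
  have "(\<lambda>i. B / q * (1 / q) ^ i) sums (B / q * (1 / (1 - 1 / q)))"
    by (rule sums_mult, rule geometric_sums) (use assms in auto)
  also have "B / q * (1 / (1 - 1 / q)) = B / (q - 1)"
    using assms by (simp add: field_simps)
  finally show ?thesis by (simp add: power_divide)
qed

lemma summable_digits:
  fixes q :: real and c :: "nat \<Rightarrow> real"
  assumes "q > 1" "\<And>i. \<bar>c i\<bar> \<le> B"
  shows "summable (\<lambda>i. c i / q ^ Suc i)"
  by (rule summable_comparison_test'[OF sums_summable[OF geometric_digit_sums[of q B]], of 0])
     (use assms in \<open>auto simp: abs_mult intro!: divide_right_mono\<close>)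

lemma sums_digits_le:
  fixes q :: real
  assumes "q > 1" "\<And>i. c i \<le> B" "(\<lambda>i. c i / q ^ Suc i) sums x"
  shows "x \<le> B / (q - 1)"
  by (rule sums_le[OF _ assms(3) geometric_digit_sums])
     (use assms in \<open>auto intro!: divide_right_mono\<close>)

lemma sums_digits_abs_le:
  fixes q :: real
  assumes "q > 1" "\<And>i. \<bar>c i\<bar> \<le> B" "(\<lambda>i. c i / q ^ Suc i) sums x"
  shows "\<bar>x\<bar> \<le> B / (q - 1)"
proof -
  have "(\<lambda>i. - c i / q ^ Suc i) sums - x"
    using sums_minus[OF assms(3)] by simp
  then have "- x \<le> B / (q - 1)"
    by (rule sums_digits_le[rotated 2]) (use assms in \<open>auto simp: abs_le_iff\<close>)
  moreover have "x \<le> B / (q - 1)"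
    by (rule sums_digits_le[OF _ _ assms(3)]) (use assms in \<open>auto simp: abs_le_iff\<close>)
  ultimately show ?thesis by simp
qed

lemma sums_digits_shift:
  fixes q :: real
  assumes "q > 1"
  shows "(\<lambda>i. c (i + n) / q ^ Suc i) sums y \<longleftrightarrow>
         (\<lambda>i. c i / q ^ Suc i) sums ((\<Sum>i<n. c i / q ^ Suc i) + y / q ^ n)"
proof -
  have "(\<lambda>i. c i / q ^ Suc i) sums ((\<Sum>i<n. c i / q ^ Suc i) + y / q ^ n)
     \<longleftrightarrow> (\<lambda>i. c (i + n) / q ^ Suc (i + n)) sums (y / q ^ n)"
    by (subst sums_iff_shift[of _ n]) (simp add: add.commute)
  also have "(\<lambda>i. c (i + n) / q ^ Suc (i + n)) = (\<lambda>i. c (i + n) / q ^ Suc i / q ^ n)"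
    by (simp add: power_add mult.assoc)
  also have "\<dots> sums (y / q ^ n) \<longleftrightarrow> (\<lambda>i. c (i + n) / q ^ Suc i) sums y"
    using assms sums_mult_iff[of "1 / q ^ n" "\<lambda>i. c (i + n) / q ^ Suc i" y] by (simp add: mult_ac)
  finally show ?thesis by simp
qed

lemma sums_digits_tail:
  fixes q :: real
  assumes q: "q > 1" and c: "(\<lambda>i. c i / q ^ Suc i) sums x"
  obtains y where "(\<lambda>i. c (i + n) / q ^ Suc i) sums y" "x = (\<Sum>i<n. c i / q ^ Suc i) + y / q ^ n"
proof
  let ?y = "q ^ n * (x - (\<Sum>i<n. c i / q ^ Suc i))"
  show *: "x = (\<Sum>i<n. c i / q ^ Suc i) + ?y / q ^ n" using q by simp
  show "(\<lambda>i. c (i + n) / q ^ Suc i) sums ?y"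
    using c q by (subst sums_digits_shift) auto
qed

text \<open>Meant for the difference of two digit sequences, with \<open>k\<close> their first
  disagreement; with \<open>k = 0\<close> it peels off one digit.\<close>

lemma sums_digits_leading_zeros:
  fixes q :: real
  assumes q: "q > 1" and c: "(\<lambda>i. c i / q ^ Suc i) sums x" and z: "\<And>i. i < k \<Longrightarrow> c i = 0"
  obtains y where "(\<lambda>i. c (i + Suc k) / q ^ Suc i) sums y" "x * q ^ Suc k = c k + y"
proof -
  obtain y where y: "(\<lambda>i. c (i + Suc k) / q ^ Suc i) sums y"
     "x = (\<Sum>i<Suc k. c i / q ^ Suc i) + y / q ^ Suc k"
    using sums_digits_tail[OF q c] by blast
  have "x = c k / q ^ Suc k + y / q ^ Suc k" using y(2) z by simp
  then have "x * q ^ Suc k = c k + y" using q by (simp add: field_simps)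
  then show ?thesis using y(1) that by blast
qed

text \<open>
  Cantor expansion with variable bases: \<open>y = (\<Sum>i<n. mixed_digit N y i / (N 0 * \<dots> * N i)) +
  mixed_rem N y n / (N 0 * \<dots> * N (n - 1))\<close>.
\<close>

definition mixed_rem :: "(nat \<Rightarrow> nat) \<Rightarrow> real \<Rightarrow> nat \<Rightarrow> real" where
  "mixed_rem N y n = rec_nat y (\<lambda>i r. frac (real (N i) * r)) n"

definition mixed_digit :: "(nat \<Rightarrow> nat) \<Rightarrow> real \<Rightarrow> nat \<Rightarrow> nat" where
  "mixed_digit N y i = nat \<lfloor>real (N i) * mixed_rem N y i\<rfloor>"

lemma mixed_rem_bounds:
  assumes "y \<in> {0..<1}"
  shows "mixed_rem N y n \<in> {0..<1}"
  using assms by (cases n) (auto simp: mixed_rem_def frac_lt_1)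

lemma mixed_rem_Suc:
  assumes "y \<in> {0..<1}"
  shows "mixed_rem N y (Suc n) = real (N n) * mixed_rem N y n - real (mixed_digit N y n)"
proof -
  have "0 \<le> real (N n) * mixed_rem N y n" using mixed_rem_bounds[OF assms, of N n] by simp
  then show ?thesis by (simp add: mixed_rem_def mixed_digit_def frac_def)
qed

lemma mixed_digit_less:
  assumes "y \<in> {0..<1}" "N i \<ge> 1"
  shows "mixed_digit N y i < N i"
proof -
  have "real (N i) * mixed_rem N y i < real (N i)"
    using mixed_rem_bounds[OF assms(1), of N i] assms(2) by simp
  moreover have "0 \<le> real (N i) * mixed_rem N y i"
    using mixed_rem_bounds[OF assms(1), of N i] by simp
  ultimately show ?thesis unfolding mixed_digit_def by (simp add: floor_less_iff nat_less_iff)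
qed

text \<open>Equal digits cancel in the recursion, so each step multiplies the difference of the
  remainders by \<open>N i\<close>; remainders in [0, 1) differ by less than 1.\<close>

lemma mixed_digits_agree_imp_close:
  assumes y: "y \<in> {0..<1}" "z \<in> {0..<1}" and N: "\<And>i. N i \<ge> 1"
    and eq: "\<And>i. i < n \<Longrightarrow> mixed_digit N y i = mixed_digit N z i"
  shows "\<bar>y - z\<bar> \<le> 1 / (\<Prod>i<n. real (N i))"
proof -
  have "(y - z) * (\<Prod>i<k. real (N i)) = mixed_rem N y k - mixed_rem N z k" if "k \<le> n" for k
    using that
  proof (induction k)
    case 0
    then show ?case by (simp add: mixed_rem_def)
  next
    case (Suc k)
    then have "(y - z) * (\<Prod>i<Suc k. real (N i)) = real (N k) * (mixed_rem N y k - mixed_rem N z k)"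
      by (simp add: mult_ac)
    then show ?case
      using Suc.prems eq[of k] by (simp add: mixed_rem_Suc[OF y(1)] mixed_rem_Suc[OF y(2)] algebra_simps)
  qed
  from this[of n] have "\<bar>(y - z) * (\<Prod>i<n. real (N i))\<bar> \<le> 1"
    using mixed_rem_bounds[OF y(1), of N n] mixed_rem_bounds[OF y(2), of N n] by auto
  moreover have pos: "(\<Prod>i<n. real (N i)) > 0"
    using N by (intro prod_pos) (auto simp: Suc_le_eq)
  ultimately have "\<bar>y - z\<bar> * (\<Prod>i<n. real (N i)) \<le> 1"
    by (simp only: abs_mult abs_of_pos)
  then show ?thesis using pos by (simp add: pos_le_divide_eq)
qed

subsection \<open>Homogeneous Moran sets\<close>

text \<open>Splitting a digit into a lower end and an offset lets the offsets be the digits of a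
  Cantor expansion with bases \<open>N\<close>.\<close>

definition moran_set :: "real \<Rightarrow> (nat \<Rightarrow> nat) \<Rightarrow> (nat \<Rightarrow> nat) \<Rightarrow> real set" where
  "moran_set q lo N =
     {x. \<exists>e. (\<forall>i. e i < N i) \<and> (\<lambda>i. real (lo i + e i) / q ^ Suc i) sums x}"

primrec moran_approx :: "real \<Rightarrow> (nat \<Rightarrow> nat) \<Rightarrow> (nat \<Rightarrow> nat) \<Rightarrow> nat \<Rightarrow> real set" where
  "moran_approx q lo N 0 = {0}"
| "moran_approx q lo N (Suc n) =
     (\<lambda>(x, e). x + real (lo n + e) / q ^ Suc n) ` (moran_approx q lo N n \<times> {..<N n})"

lemma finite_moran_approx [simp]: "finite (moran_approx q lo N n)"
  by (induction n) auto

lemma card_moran_approx: "card (moran_approx q lo N n) \<le> (\<Prod>i<n. N i)"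
proof (induction n)
  case (Suc n)
  have "card (moran_approx q lo N (Suc n)) \<le> card (moran_approx q lo N n \<times> {..<N n})"
    unfolding moran_approx.simps by (intro card_image_le) auto
  also have "\<dots> \<le> (\<Prod>i<Suc n. N i)" using Suc by (simp add: card_cartesian_product)
  finally show ?case .
qed simp

lemma partial_sum_in_moran_approx:
  assumes "\<And>i. e i < N i"
  shows "(\<Sum>i<n. real (lo i + e i) / q ^ Suc i) \<in> moran_approx q lo N n"
proof (induction n)
  case (Suc n)
  then show ?case using assms[of n] by (auto intro!: image_eqI[of _ _ "(_, e n)"] simp del: of_nat_add)
qed simp

context
  fixes q :: real and m :: nat and lo N :: "nat \<Rightarrow> nat"
  assumes q: "q > real m + 1" and lo: "\<And>i. lo i + N i \<le> Suc m" and N: "\<And>i. N i \<ge> 1"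
begin

private lemma q_gt_1: "q > 1" using q by simp

private lemma moran_digit_le: "e i < N i \<Longrightarrow> lo i + e i \<le> m"
  using lo[of i] by simp

text \<open>The tail after \<open>n\<close> digits lies between 0 and \<open>m / (q - 1)\<close>,
  which is below 1 because \<open>q > m + 1\<close>.\<close>

lemma moran_set_cover:
  "moran_set q lo N \<subseteq> (\<Union>x\<in>moran_approx q lo N n. {x..x + 1 / q ^ n})"
proof
  fix x assume "x \<in> moran_set q lo N"
  then obtain e where e: "\<And>i. e i < N i" "(\<lambda>i. real (lo i + e i) / q ^ Suc i) sums x"
    by (auto simp: moran_set_def)
  obtain y where y: "(\<lambda>i. real (lo (i + n) + e (i + n)) / q ^ Suc i) sums y"
    "x = (\<Sum>i<n. real (lo i + e i) / q ^ Suc i) + y / q ^ n"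
    using sums_digits_tail[OF q_gt_1 e(2)] by blast
  have "0 \<le> y"
    by (rule sums_le[OF _ sums_zero y(1)]) (use q_gt_1 in auto)
  moreover have "y \<le> real m / (q - 1)"
    using moran_digit_le e by (intro sums_digits_le[OF q_gt_1 _ y(1)]) (simp del: of_nat_add)
  then have "y \<le> 1" using q by (simp add: order_trans[OF _ less_imp_le] divide_less_eq)
  ultimately have "0 \<le> y / q ^ n" "y / q ^ n \<le> 1 / q ^ n"
    using q_gt_1 by (auto intro!: divide_right_mono)
  then show "x \<in> (\<Union>x\<in>moran_approx q lo N n. {x..x + 1 / q ^ n})"
    unfolding y(2) using e(1)
    by (intro UN_I[of "\<Sum>i<n. real (lo i + e i) / q ^ Suc i"] partial_sum_in_moran_approx) auto
qed

text \<open>At the first disagreement the digits differ by at least 1, and the tails can compensate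
  at most \<open>m / (q - 1)\<close>. The resulting gap is positive since
  \<open>q > m + 1\<close>.\<close>

lemma moran_separation:
  assumes e: "\<And>i. e i < N i" "\<And>i. e' i < N i"
    and x: "(\<lambda>i. real (lo i + e i) / q ^ Suc i) sums x" "(\<lambda>i. real (lo i + e' i) / q ^ Suc i) sums x'"
    and k: "\<And>i. i < k \<Longrightarrow> e i = e' i" "e k \<noteq> e' k"
  shows "1 - real m / (q - 1) \<le> \<bar>x - x'\<bar> * q ^ Suc k"
proof -
  define c where "c i = real (e i) - real (e' i)" for i
  have "(\<lambda>i. c i / q ^ Suc i) sums (x - x')"
    using sums_diff[OF x] by (simp add: c_def diff_divide_distrib add_divide_distrib)
  then obtain y where y: "(\<lambda>i. c (i + Suc k) / q ^ Suc i) sums y" "(x - x') * q ^ Suc k = c k + y"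
    using sums_digits_leading_zeros[OF q_gt_1, of c "x - x'" k] k(1) by (auto simp: c_def)
  have "\<bar>c i\<bar> \<le> real m" for i
    using moran_digit_le[of e i] moran_digit_le[of e' i] e by (simp add: c_def)
  then have "\<bar>y\<bar> \<le> real m / (q - 1)"
    by (intro sums_digits_abs_le[OF q_gt_1 _ y(1)])
  moreover have "1 \<le> \<bar>c k\<bar>" using k(2) by (simp add: c_def)
  ultimately have "1 - real m / (q - 1) \<le> \<bar>(x - x') * q ^ Suc k\<bar>" unfolding y(2) by linarith
  then show ?thesis using q_gt_1 by (simp add: abs_mult)
qed

lemma hausdorff_dim_moran_le:
  assumes "0 \<le> s" "\<exists>\<^sub>F n in sequentially. real (\<Prod>i<n. N i) \<le> C * q powr (real n * s)"
  shows "hausdorff_dim (moran_set q lo N) \<le> ereal s"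
proof (rule hausdorff_dim_le[OF q_gt_1 assms(1)])
  show "\<exists>\<^sub>F n in sequentially. \<exists>F. finite F \<and> real (card F) \<le> C * q powr (real n * s) \<and>
          moran_set q lo N \<subseteq> (\<Union>x\<in>F. {x..x + 1 / q ^ n})"
    using assms(2)
  proof (rule frequently_mono[rotated], safe)
    fix n assume "real (\<Prod>i<n. N i) \<le> C * q powr (real n * s)"
    moreover have "real (card (moran_approx q lo N n)) \<le> real (\<Prod>i<n. N i)"
      using card_moran_approx of_nat_le_iff by blast
    ultimately show "\<exists>F. finite F \<and> real (card F) \<le> C * q powr (real n * s) \<and>
          moran_set q lo N \<subseteq> (\<Union>x\<in>F. {x..x + 1 / q ^ n})"
      by (intro exI[of _ "moran_approx q lo N n"]) (auto intro: order_trans dest: subsetD[OF moran_set_cover[of n]])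
  qed
qed

text \<open>The map \<open>h\<close> rereads the Cantor digits of \<open>y\<close> as offsets in
  base \<open>q\<close>. If the digits of \<open>y\<close> and \<open>z\<close> first differ at
  \<open>k\<close>, then \<open>y\<close> and \<open>z\<close> are within a constant times
  \<open>q powr (- k * s)\<close>, while \<open>h y\<close> and \<open>h z\<close> are at least
  \<open>K / q ^ Suc k\<close> apart; this is the Hoelder condition.\<close>

lemma hausdorff_dim_moran_ge:
  assumes c: "c > 0" and P: "\<And>n. c * q powr (real n * s) \<le> real (\<Prod>i<n. N i)"
  shows "ereal s \<le> hausdorff_dim (moran_set q lo N)"
proof (cases "s > 0")
  case False
  have "0 \<le> hausdorff_dim (moran_set q lo N)"
    unfolding hausdorff_dim_def by (intro Inf_greatest) auto
  moreover have "ereal s \<le> 0" using False by simp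
  ultimately show ?thesis by (rule order_trans[rotated])
next
  case s: True
  define K where "K = 1 - real m / (q - 1)"
  have K: "K > 0" using q by (simp add: K_def)
  define h where "h y = (\<Sum>i. real (lo i + mixed_digit N y i) / q ^ Suc i)" for y
  have h: "(\<lambda>i. real (lo i + mixed_digit N y i) / q ^ Suc i) sums h y" if "y \<in> {0..<1}" for y
    unfolding h_def using moran_digit_le mixed_digit_less[of _ N] N that
    by (intro summable_sums summable_digits[OF q_gt_1, of _ "real m"]) (simp del: of_nat_add)
  show ?thesis
  proof (rule hausdorff_dim_ge[where h = h and C = "(q / K) powr s / c"])
    show "h y \<in> moran_set q lo N" if "y \<in> {0..<1}" for y
      unfolding moran_set_def using h[OF that] mixed_digit_less[OF that, of N] N by blast
    fix y z :: real assume yz: "y \<in> {0..<1}" "z \<in> {0..<1}"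
    have close: "\<bar>y - z\<bar> \<le> (1 / c) * (1 / q ^ n) powr s"
      if "\<And>i. i < n \<Longrightarrow> mixed_digit N y i = mixed_digit N z i" for n
    proof -
      have "(\<Prod>i<n. N i) > 0" using N by (intro prod_pos) (auto simp: Suc_le_eq)
      then have pos: "real (\<Prod>i<n. N i) > 0" by linarith
      have "\<bar>y - z\<bar> \<le> 1 / real (\<Prod>i<n. N i)"
        using mixed_digits_agree_imp_close[OF yz, of N n] N that by simp
      also have "\<dots> \<le> 1 / (c * q powr (real n * s))"
        using c q_gt_1 pos by (intro divide_left_mono P mult_pos_pos) auto
      also have "\<dots> = (1 / c) * (1 / q ^ n) powr s"
      proof -
        have "1 / q ^ n = q powr (- real n)" using q_gt_1 by (simp add: powr_minus_divide powr_realpow)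
        then have "(1 / q ^ n) powr s = q powr (- (real n * s))" by (simp add: powr_powr)
        then show ?thesis by (simp add: powr_minus_divide)
      qed
      finally show ?thesis .
    qed
    show "\<bar>y - z\<bar> \<le> (q / K) powr s / c * dist (h y) (h z) powr s"
    proof (cases "\<exists>k. mixed_digit N y k \<noteq> mixed_digit N z k")
      case True
      define k where "k = (LEAST k. mixed_digit N y k \<noteq> mixed_digit N z k)"
      have k: "mixed_digit N y k \<noteq> mixed_digit N z k"
        unfolding k_def using True by (rule LeastI_ex)
      have k': "mixed_digit N y i = mixed_digit N z i" if "i < k" for i
        using not_less_Least that unfolding k_def by blast
      have "K \<le> \<bar>h y - h z\<bar> * q ^ Suc k"
        unfolding K_def
        by (rule moran_separation[OF _ _ h h k' k]) (use yz N mixed_digit_less in auto)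
      then have "1 / q ^ k \<le> q / K * \<bar>h y - h z\<bar>"
        using K q_gt_1 by (simp add: field_simps)
      then have "(1 / q ^ k) powr s \<le> (q / K * \<bar>h y - h z\<bar>) powr s"
        using s q_gt_1 by (intro powr_mono2) auto
      also have "\<dots> = (q / K) powr s * \<bar>h y - h z\<bar> powr s"
        by (rule powr_mult)
      finally have "1 / c * (1 / q ^ k) powr s \<le> 1 / c * ((q / K) powr s * \<bar>h y - h z\<bar> powr s)"
        using c by (intro mult_left_mono) auto
      then show ?thesis using close[of k, OF k'] by (simp add: dist_real_def)
    next
      case False
      \<comment> \<open>All digits agree, so the closeness bound holds for every \<open>n\<close>;
        its limit is 0 because \<open>s > 0\<close>, and so \<open>y = z\<close>.\<close>
      have "(\<lambda>n. (1 / c) * ((1 / q) ^ n) powr s) \<longlonglongrightarrow> (1 / c) * 0 powr s"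
        using q_gt_1 s by (intro tendsto_intros tendsto_powr' LIMSEQ_power_zero) auto
      moreover have "\<bar>y - z\<bar> \<le> (1 / c) * ((1 / q) ^ n) powr s" for n
        using close[of n] False by (simp add: power_divide)
      ultimately have "\<bar>y - z\<bar> \<le> (1 / c) * 0 powr s"
        by (intro LIMSEQ_le_const) auto
      then show ?thesis using s c by (simp add: order_trans[of _ 0])
    qed
  qed (use s c K q_gt_1 in auto)
qed

end

subsection \<open>Unique expansions\<close>

lemma Gamma_setI:
  assumes "\<And>i. n i \<le> m" "(\<lambda>i. real (n i) / q ^ Suc i) sums x"
  shows "x \<in> Gamma_set q m"
  unfolding Gamma_set_def is_expansion_def using assms
  by (intro CollectI exI[of _ "\<lambda>i. real (n i)"]) auto

text \<open>If \<open>y\<close> has digits \<open>\<beta>\<close> and \<open>y + t\<close> has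
  digits \<open>\<alpha>\<close>, then \<open>\<alpha> - \<beta>\<close> expands \<open>t\<close>,
  so uniqueness forces it to be \<open>\<tau>\<close>. Hence \<open>\<alpha> i\<close> runs from
  \<open>max 0 (\<tau> i)\<close>, written \<open>nat (\<tau> i)\<close>, to
  \<open>m + min 0 (\<tau> i)\<close>, which leaves \<open>m + 1 - \<bar>\<tau> i\<bar>\<close>
  values.\<close>

lemma moran_set_eq_Inter:
  fixes q :: real and \<tau> :: "nat \<Rightarrow> int"
  assumes \<tau>: "\<And>i. \<bar>\<tau> i\<bar> \<le> int m"
    and exp: "is_expansion q (real_of_int ` {- int m..int m}) (\<lambda>i. of_int (\<tau> i)) t"
    and uniq: "t \<in> unique_exp_set m q"
  shows "Gamma_set q m \<inter> (\<lambda>x. x + t) ` Gamma_set q m =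
         moran_set q (\<lambda>i. nat (\<tau> i)) (\<lambda>i. Suc m - nat \<bar>\<tau> i\<bar>)"
proof safe
  fix y assume y: "y \<in> Gamma_set q m" and yt: "y + t \<in> Gamma_set q m"
  from y obtain b where "\<And>i. b i \<in> real ` {0..m}" and bs: "(\<lambda>i. b i / q ^ Suc i) sums y"
    by (auto simp: Gamma_set_def is_expansion_def)
  then have "\<forall>i. \<exists>n\<le>m. b i = real n" by fastforce
  then obtain \<beta> where \<beta>: "\<And>i. \<beta> i \<le> m" "\<And>i. b i = real (\<beta> i)" by metis
  from yt obtain a where "\<And>i. a i \<in> real ` {0..m}" and as: "(\<lambda>i. a i / q ^ Suc i) sums (y + t)"
    by (auto simp: Gamma_set_def is_expansion_def)
  then have "\<forall>i. \<exists>n\<le>m. a i = real n" by fastforce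
  then obtain \<alpha> where \<alpha>: "\<And>i. \<alpha> i \<le> m" "\<And>i. a i = real (\<alpha> i)" by metis
  have "is_expansion q (real_of_int ` {- int m..int m}) (\<lambda>i. of_int (int (\<alpha> i) - int (\<beta> i))) t"
    unfolding is_expansion_def
  proof (intro conjI allI)
    show "real_of_int (int (\<alpha> i) - int (\<beta> i)) \<in> real_of_int ` {- int m..int m}" for i
      using \<alpha>(1)[of i] \<beta>(1)[of i] by (intro imageI) auto
    show "(\<lambda>i. real_of_int (int (\<alpha> i) - int (\<beta> i)) / q ^ Suc i) sums t"
      using sums_diff[OF as bs] by (simp add: \<alpha>(2) \<beta>(2) diff_divide_distrib)
  qed
  then have "(\<lambda>i. real_of_int (int (\<alpha> i) - int (\<beta> i))) = (\<lambda>i. of_int (\<tau> i))"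
    using exp uniq unfolding unique_exp_set_def by blast
  then have eq: "int (\<alpha> i) - int (\<beta> i) = \<tau> i" for i
    by (metis of_int_eq_iff)
  have *: "nat (\<tau> i) \<le> \<alpha> i" "\<alpha> i - nat (\<tau> i) < Suc m - nat \<bar>\<tau> i\<bar>" for i
    using eq[of i] \<alpha>(1)[of i] \<beta>(1)[of i] by linarith+
  then have "(\<lambda>i. real (nat (\<tau> i) + (\<alpha> i - nat (\<tau> i))) / q ^ Suc i) sums (y + t)"
    using as \<alpha>(2) by (simp del: of_nat_add)
  then show "y + t \<in> moran_set q (\<lambda>i. nat (\<tau> i)) (\<lambda>i. Suc m - nat \<bar>\<tau> i\<bar>)"
    unfolding moran_set_def using *(2) by (intro CollectI exI[of _ "\<lambda>i. \<alpha> i - nat (\<tau> i)"]) auto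
next
  fix x assume "x \<in> moran_set q (\<lambda>i. nat (\<tau> i)) (\<lambda>i. Suc m - nat \<bar>\<tau> i\<bar>)"
  then obtain e where e: "\<And>i. e i < Suc m - nat \<bar>\<tau> i\<bar>"
    and x: "(\<lambda>i. real (nat (\<tau> i) + e i) / q ^ Suc i) sums x"
    by (auto simp: moran_set_def)
  have "nat (\<tau> i) + e i \<le> m" for i using e[of i] by auto
  then show "x \<in> Gamma_set q m" by (rule Gamma_setI[OF _ x])
  \<comment> \<open>Positive minus negative part:
    \<open>nat (\<tau> i) - \<tau> i = nat (- \<tau> i)\<close>, so subtracting \<open>t\<close>
    again leaves admissible digits.\<close>
  have xt: "(\<lambda>i. real (nat (- \<tau> i) + e i) / q ^ Suc i) sums (x - t)"
  proof -
    have "(\<lambda>i. real (nat (\<tau> i) + e i) / q ^ Suc i - of_int (\<tau> i) / q ^ Suc i) sums (x - t)"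
      using exp x by (intro sums_diff) (auto simp: is_expansion_def)
    moreover have "real (nat (\<tau> i) + e i) - of_int (\<tau> i) = real (nat (- \<tau> i) + e i)" for i
      by (cases "\<tau> i \<ge> 0") auto
    ultimately show ?thesis by (simp only: diff_divide_distrib[symmetric])
  qed
  have "nat (- \<tau> i) + e i \<le> m" for i using e[of i] by auto
  then have "x - t \<in> Gamma_set q m" by (rule Gamma_setI[OF _ xt])
  then show "x \<in> (\<lambda>x. x + t) ` Gamma_set q m"
    by (intro image_eqI[of _ _ "x - t"]) auto
qed

text \<open>At the first place where a rival \<open>c\<close> differs from \<open>\<tau>\<close>,
  the difference of the digits equals the tail of \<open>\<tau>\<close> minus the tail of
  \<open>c\<close>. Its modulus is below \<open>1 / q + m / (q - 1) <= 1\<close>, impossible for a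
  nonzero integer.\<close>

lemma unique_expansionI:
  fixes q :: real and \<tau> :: "nat \<Rightarrow> int"
  assumes q: "q > 1" and le: "1 / q + real m / (q - 1) \<le> 1"
    and exp: "is_expansion q (real_of_int ` {- int m..int m}) (\<lambda>i. of_int (\<tau> i)) t"
    and tails: "\<And>k y. (\<lambda>i. of_int (\<tau> (i + k)) / q ^ Suc i) sums y \<Longrightarrow> \<bar>y\<bar> < 1 / q"
  shows "t \<in> unique_exp_set m q"
proof -
  have "c = (\<lambda>i. of_int (\<tau> i))" if c: "is_expansion q (real_of_int ` {- int m..int m}) c t" for c
  proof (rule ccontr)
    assume ne: "c \<noteq> (\<lambda>i. of_int (\<tau> i))"
    define d where "d i = c i - of_int (\<tau> i)" for i
    define k where "k = (LEAST k. d k \<noteq> 0)"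
    have "\<exists>k. d k \<noteq> 0" using ne by (auto simp: d_def)
    then have k: "d k \<noteq> 0" unfolding k_def by (rule LeastI_ex)
    have k': "d i = 0" if "i < k" for i using not_less_Least that unfolding k_def by blast
    have sd: "(\<lambda>i. d i / q ^ Suc i) sums (t - t)"
      unfolding d_def diff_divide_distrib using c exp by (intro sums_diff) (auto simp: is_expansion_def)
    obtain y where y: "(\<lambda>i. d (i + Suc k) / q ^ Suc i) sums y" "(t - t) * q ^ Suc k = d k + y"
      using sums_digits_leading_zeros[OF q sd, of k] k' by blast
    obtain w where w: "(\<lambda>i. of_int (\<tau> (i + Suc k)) / q ^ Suc i) sums w"
      using sums_digits_tail[OF q, of "\<lambda>i. of_int (\<tau> i)" t "Suc k"] exp
      unfolding is_expansion_def by blast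
    have cb: "\<bar>c i\<bar> \<le> real m" for i
      using c by (auto simp: is_expansion_def dest!: spec[of _ i])
    obtain v where v: "(\<lambda>i. c (i + Suc k) / q ^ Suc i) sums v"
      using sums_digits_tail[OF q, of c t "Suc k"] c unfolding is_expansion_def by blast
    have "\<bar>v\<bar> \<le> real m / (q - 1)" by (rule sums_digits_abs_le[OF q cb v])
    moreover have "\<bar>w\<bar> < 1 / q" using tails[OF w] .
    moreover have "y = v - w"
      using sums_unique2[OF y(1)] sums_diff[OF v w] by (simp add: d_def diff_divide_distrib)
    moreover have "1 \<le> \<bar>d k\<bar>"
    proof -
      obtain z where "c k = of_int z" using c by (auto simp: is_expansion_def)
      then have z: "d k = of_int (z - \<tau> k)" by (simp add: d_def)
      then have "1 \<le> \<bar>z - \<tau> k\<bar>" using k by auto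
      then show ?thesis unfolding z by linarith
    qed
    ultimately show False using y(2) le by auto
  qed
  then show ?thesis unfolding unique_exp_set_def using exp by blast
qed

text \<open>Digits are chosen by rounding \<open>q * r\<close> and clipping to the alphabet. The
  remainder stays within \<open>K = m / (q - 1)\<close>: the rounding error is at most
  \<open>1 / 2 <= K\<close> since \<open>q <= 2 * m + 1\<close>, and after clipping
  \<open>q * K = K + m\<close> gives the bound.\<close>

lemma ex_expansion:
  fixes q :: real
  assumes q: "q > 1" "q \<le> 2 * real m + 1" and x: "\<bar>x\<bar> \<le> real m / (q - 1)"
  shows "\<exists>c. is_expansion q (real_of_int ` {- int m..int m}) c x"
proof -
  define K where "K = real m / (q - 1)"
  have K: "1 / 2 \<le> K" "q * K = K + m" using q by (simp_all add: K_def field_simps)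
  define dig where "dig r = max (- int m) (min (int m) (round (q * r)))" for r
  define R where "R n = rec_nat x (\<lambda>i r. q * r - of_int (dig r)) n" for n
  have step: "\<bar>q * r - of_int (dig r)\<bar> \<le> K" if "\<bar>r\<bar> \<le> K" for r
  proof -
    have "\<bar>q * r\<bar> \<le> q * K" using that q by (simp add: abs_mult)
    then have b: "\<bar>q * r\<bar> \<le> K + m" using K by simp
    have rd: "\<bar>of_int (round (q * r)) - q * r\<bar> \<le> 1 / 2" by (rule of_int_round_abs_le)
    consider "round (q * r) > int m" | "round (q * r) < - int m" | "\<bar>round (q * r)\<bar> \<le> int m"
      by linarith
    then show ?thesis
    proof cases
      case 1
      then have "real_of_int (round (q * r)) \<ge> real m + 1" by linarith
      moreover have "dig r = int m" using 1 by (simp add: dig_def)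
      ultimately show ?thesis using rd b K unfolding abs_le_iff by simp
    next
      case 2
      then have "real_of_int (round (q * r)) \<le> - real m - 1" by linarith
      moreover have "dig r = - int m" using 2 by (simp add: dig_def)
      ultimately show ?thesis using rd b K unfolding abs_le_iff by simp
    next
      case 3
      then have "dig r = round (q * r)" by (simp add: dig_def)
      then show ?thesis using rd K by (simp add: abs_minus_commute)
    qed
  qed
  have R: "\<bar>R n\<bar> \<le> K" for n
    by (induction n) (use x step in \<open>auto simp: R_def K_def\<close>)
  have part: "(\<Sum>i<n. of_int (dig (R i)) / q ^ Suc i) = x - R n / q ^ n" for n
  proof (induction n)
    case (Suc n)
    have "R (Suc n) = q * R n - of_int (dig (R n))" by (simp add: R_def)
    then show ?case using Suc q by (simp add: diff_divide_distrib)
  qed (simp add: R_def)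
  have "(\<lambda>n. R n / q ^ n) \<longlonglongrightarrow> 0"
  proof (rule Lim_null_comparison)
    show "\<forall>\<^sub>F n in sequentially. norm (R n / q ^ n) \<le> K * (1 / q) ^ n"
      using R q by (intro always_eventually) (auto simp: power_divide abs_mult intro!: divide_right_mono)
    show "(\<lambda>n. K * (1 / q) ^ n) \<longlonglongrightarrow> 0"
      using q by (intro tendsto_mult_right_zero LIMSEQ_power_zero) auto
  qed
  then have "(\<lambda>n. x - R n / q ^ n) \<longlonglongrightarrow> x - 0" by (intro tendsto_intros)
  then have "(\<lambda>i. of_int (dig (R i)) / q ^ Suc i) sums x"
    unfolding sums_def part by simp
  then show ?thesis
    unfolding is_expansion_def by (intro exI[of _ "\<lambda>i. of_int (dig (R i))"]) (auto simp: dig_def)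
qed

subsection \<open>Above the critical base\<close>

lemma q_crit_gt: "m \<ge> 1 \<Longrightarrow> real m + 1 < q_crit m"
proof -
  assume "m \<ge> 1"
  then have "real m < sqrt (real m * (real m + 4))"
    by (intro real_less_rsqrt) (simp add: power2_eq_square algebra_simps)
  then show ?thesis by (simp add: q_crit_def)
qed

lemma q_crit_less: "q_crit m < real m + 2"
proof -
  have "sqrt (real m * (real m + 4)) < real m + 2"
    by (intro real_less_lsqrt) (simp_all add: power2_eq_square algebra_simps)
  then show ?thesis by (simp add: q_crit_def)
qed

text \<open>Clearing denominators gives \<open>q^2 - (m + 2) * q + 1 >= 0\<close>, with discriminant
  \<open>m * (m + 4)\<close>; \<open>q > m + 1\<close> excludes the range below the smaller
  root.\<close>

lemma q_crit_le_iff: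
  assumes "m \<ge> 1" "q > real m + 1"
  shows "q_crit m \<le> q \<longleftrightarrow> 1 / q + real m / (q - 1) \<le> 1"
proof -
  define r where "r = sqrt (real m * (real m + 4))"
  have r: "r \<ge> 0" "r\<^sup>2 = real m * (real m + 4)" by (simp_all add: r_def)
  have "1 / q + real m / (q - 1) = (q - 1 + real m * q) / (q * (q - 1))"
    using assms by (simp add: field_simps)
  then have "1 / q + real m / (q - 1) \<le> 1 \<longleftrightarrow> q - 1 + real m * q \<le> q * (q - 1)"
    using assms by (simp add: divide_le_eq)
  also have "\<dots> \<longleftrightarrow> r\<^sup>2 \<le> (2 * q - (real m + 2))\<^sup>2"
    unfolding r by (auto simp: power2_eq_square algebra_simps)
  also have "\<dots> \<longleftrightarrow> r \<le> 2 * q - (real m + 2)"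
    using assms r by (intro power_mono_iff) auto
  also have "\<dots> \<longleftrightarrow> q_crit m \<le> q" by (auto simp: q_crit_def r_def)
  finally show ?thesis by simp
qed

text \<open>For \<open>p\<close> with values in \<open>{0, 1}\<close>, the nonzero digits \<open>p (i + 1) - p i\<close> alternate in sign.\<close>

lemma difference_digits_less:
  fixes q :: real and p :: "nat \<Rightarrow> real"
  assumes q: "q > 1" and p: "\<And>i. p i \<in> {0..1}" and j: "k < j" "p j < 1"
    and y: "(\<lambda>i. (p (Suc (i + k)) - p (i + k)) / q ^ Suc i) sums y"
  shows "y < 1 / q"
proof -
  \<comment> \<open>The sum is that of the shifted sequence minus that of the original:
    \<open>y = S - P\<close> with \<open>q * P = p k + S\<close>. So \<open>y < 1 / q\<close>
    follows from \<open>p k >= 0\<close> and \<open>S < 1 / (q - 1)\<close>; the last inequality is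
    strict thanks to the place \<open>j\<close>.\<close>
  have "summable (\<lambda>i. p (i + k) / q ^ Suc i)"
    using p by (intro summable_digits[OF q, of _ 1]) (auto simp: abs_le_iff)
  then obtain P where P: "(\<lambda>i. p (i + k) / q ^ Suc i) sums P" by (auto simp: summable_def)
  then obtain S where S: "(\<lambda>i. p (Suc (i + k)) / q ^ Suc i) sums S" "P * q ^ Suc 0 = p k + S"
    using sums_digits_leading_zeros[OF q P, of 0] by auto
  have "y = S - P"
    using sums_unique2[OF y] sums_diff[OF S(1) P] by (simp add: diff_divide_distrib)
  moreover have "S < 1 / (q - 1)"
  proof -
    have d: "(\<lambda>i. (1 - p (Suc (i + k))) / q ^ Suc i) sums (1 / (q - 1) - S)"
      using sums_diff[OF geometric_digit_sums[OF q, of 1] S(1)] by (simp add: diff_divide_distrib)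
    have "0 < (\<Sum>i. (1 - p (Suc (i + k))) / q ^ Suc i)"
      using p j q by (intro suminf_pos2[OF sums_summable[OF d], of "j - Suc k"]) auto
    then show ?thesis using sums_unique[OF d] by simp
  qed
  then have "S * (q - 1) < 1" using q by (simp add: field_simps)
  moreover have "P = (p k + S) / q" using S(2) q by (simp add: field_simps)
  moreover have "p k \<ge> 0" using p[of k] by simp
  ultimately show ?thesis using q by (simp add: field_simps)
qed

section \<open>Integer sequences of prescribed density\<close>

definition floor_seq :: "real \<Rightarrow> nat \<Rightarrow> nat" where
  "floor_seq \<alpha> n = nat \<lfloor>real n * \<alpha>\<rfloor>"

lemma floor_seq_le: "0 \<le> \<alpha> \<Longrightarrow> real (floor_seq \<alpha> n) \<le> real n * \<alpha>"
  by (simp add: floor_seq_def)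

lemma floor_seq_gt: "0 \<le> \<alpha> \<Longrightarrow> real n * \<alpha> - 1 < real (floor_seq \<alpha> n)"
  by (simp add: floor_seq_def)

lemma floor_seq_Suc:
  assumes "0 \<le> \<alpha>" "\<alpha> \<le> 1"
  shows "floor_seq \<alpha> (Suc n) = floor_seq \<alpha> n \<or> floor_seq \<alpha> (Suc n) = Suc (floor_seq \<alpha> n)"
proof -
  have "real (Suc n) * \<alpha> = real n * \<alpha> + \<alpha>" by (simp add: algebra_simps)
  then have "real (floor_seq \<alpha> (Suc n)) < real (floor_seq \<alpha> n) + 2"
    "real (floor_seq \<alpha> n) < real (floor_seq \<alpha> (Suc n)) + 1"
    using floor_seq_le[of \<alpha> n] floor_seq_le[of \<alpha> "Suc n"] floor_seq_gt[of \<alpha> n]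
      floor_seq_gt[of \<alpha> "Suc n"] assms by linarith+
  then show ?thesis by linarith
qed

lemma floor_seq_surj:
  assumes "0 < \<alpha>" "\<alpha> \<le> 1"
  obtains n where "floor_seq \<alpha> n = v" "v \<le> n"
proof -
  \<comment> \<open>The least \<open>n\<close> with \<open>n * \<alpha> >= v\<close>; since
    \<open>\<alpha> <= 1\<close>, it does not overshoot to \<open>v + 1\<close>.\<close>
  define n where "n = nat \<lceil>real v / \<alpha>\<rceil>"
  have n: "real v / \<alpha> \<le> real n" "real n < real v / \<alpha> + 1"
    using assms by (auto simp: n_def) linarith+
  have "real v \<le> real n * \<alpha>" using n(1) assms by (simp add: field_simps)
  moreover have "real n * \<alpha> < real v + 1"
    using n(2) assms mult_strict_right_mono[OF n(2), of \<alpha>] by (simp add: field_simps)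
  ultimately have "floor_seq \<alpha> n = v"
    unfolding floor_seq_def by (metis floor_eq_iff int_nat_eq nat_int of_int_of_nat_eq)
  moreover have "real n * \<alpha> \<le> real n" using assms by (simp add: mult_left_le)
  then have "v \<le> n" using \<open>real v \<le> real n * \<alpha>\<close> by linarith
  ultimately show ?thesis using that by blast
qed

lemma interval_subset_dim_set:
  assumes m: "m \<ge> 1" and q: "q \<ge> q_crit m"
    and s: "ln (real m) / ln q \<le> s" "s \<le> ln (real m + 1) / ln q"
  shows "ereal s \<in> dim_set m q"
proof -
  have qm: "q > real m + 1" using q_crit_gt[OF m] q by simp
  then have q1: "q > 1" by simp
  have lnq: "ln q > 0" using q1 by simp
  have lnm: "ln (real m) < ln (real m + 1)" using m by simp
  have "0 \<le> ln (real m) / ln q" using m lnq by simp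
  then have s0: "0 \<le> s" using s(1) by simp
  \<comment> \<open>The density of nonzero digits for which
    \<open>s * ln q = (1 - \<alpha>) * ln (m + 1) + \<alpha> * ln m\<close>.\<close>
  define \<alpha> where "\<alpha> = (ln (real m + 1) - s * ln q) / (ln (real m + 1) - ln (real m))"
  have \<alpha>: "0 \<le> \<alpha>" "\<alpha> \<le> 1"
    using s lnq lnm by (auto simp: \<alpha>_def field_simps)
  define f where "f = floor_seq \<alpha>"
  define p where "p i = f i mod 2" for i
  define \<tau> where "\<tau> i = int (p (Suc i)) - int (p i)" for i
  have f0: "f 0 = 0" by (simp add: f_def floor_seq_def)
  have fS: "f (Suc n) = f n \<or> f (Suc n) = Suc (f n)" for n
    unfolding f_def using floor_seq_Suc \<alpha> by blast
  have \<tau>: "nat \<bar>\<tau> n\<bar> = f (Suc n) - f n" for n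
    using fS[of n] unfolding \<tau>_def p_def by (auto simp: mod_Suc)
  have \<tau>1: "\<bar>\<tau> n\<bar> \<le> 1" for n
    unfolding \<tau>_def p_def by auto
  have \<tau>m: "\<bar>\<tau> n\<bar> \<le> int m" for n using \<tau>1[of n] m by simp
  have "summable (\<lambda>i. of_int (\<tau> i) / q ^ Suc i)"
    using \<tau>1 by (intro summable_digits[OF q1, of _ 1]) (metis of_int_abs of_int_le_1_iff)
  then obtain t where t: "(\<lambda>i. of_int (\<tau> i) / q ^ Suc i) sums t" by (auto simp: summable_def)
  have exp: "is_expansion q (real_of_int ` {- int m..int m}) (\<lambda>i. of_int (\<tau> i)) t"
    unfolding is_expansion_def using t
  proof (intro conjI allI imageI)
    show "\<tau> i \<in> {- int m..int m}" for i using \<tau>m[of i] by auto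
  qed
  have tails: "\<bar>y\<bar> < 1 / q" if y: "(\<lambda>i. of_int (\<tau> (i + k)) / q ^ Suc i) sums y" for k y
  proof (cases "\<alpha> = 0")
    case True
    then have "\<tau> i = 0" for i by (simp add: \<tau>_def p_def f_def floor_seq_def)
    then have "y = 0" using y sums_unique2[OF y, of 0] by simp
    then show ?thesis using q1 by simp
  next
    case False
    then have pos: "\<alpha> > 0" using \<alpha> by simp
    \<comment> \<open>The value \<open>2 * (k + 1) + b\<close> has parity \<open>b\<close>, and
      \<open>f\<close> attains it at an index no smaller than the value, hence beyond
      \<open>k\<close>.\<close>
    have hit: "\<exists>j>k. p j = b" if "b < 2" for b
    proof -
      obtain n where "floor_seq \<alpha> n = 2 * (k + 1) + b" "2 * (k + 1) + b \<le> n"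
        using floor_seq_surj[OF pos \<alpha>(2)] by blast
      then show ?thesis using that by (intro exI[of _ n]) (auto simp: p_def f_def)
    qed
    obtain j where j: "k < j" "p j = 0" using hit[of 0] by auto
    obtain j' where j': "k < j'" "p j' = 1" using hit[of 1] by auto
    have p01: "real (p i) \<in> {0..1}" for i by (auto simp: p_def)
    have "y < 1 / q"
      by (rule difference_digits_less[OF q1, of "\<lambda>i. real (p i)" k j])
         (use p01 j y in \<open>auto simp: \<tau>_def\<close>)
    \<comment> \<open>Replacing \<open>p\<close> by \<open>1 - p\<close> changes the sign of every
      digit.\<close>
    moreover have "- y < 1 / q"
      by (rule difference_digits_less[OF q1, of "\<lambda>i. 1 - real (p i)" k j'])
         (use p01 j' sums_minus[OF y] in \<open>auto simp: \<tau>_def minus_divide_left\<close>)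
    ultimately show ?thesis by simp
  qed
  have tU: "t \<in> unique_exp_set m q"
    using q q_crit_le_iff[OF m qm] by (intro unique_expansionI[OF q1 _ exp tails]) auto
  define N where "N i = Suc m - nat \<bar>\<tau> i\<bar>" for i
  define lo where "lo i = nat (\<tau> i)" for i
  have eq: "Gamma_set q m \<inter> (\<lambda>x. x + t) ` Gamma_set q m = moran_set q lo N"
    unfolding N_def lo_def by (rule moran_set_eq_Inter[OF \<tau>m exp tU])
  have loN: "lo i + N i \<le> Suc m" "N i \<ge> 1" for i
    using \<tau>m[of i] by (auto simp: lo_def N_def)
  \<comment> \<open>The factor lost at each nonzero digit, where \<open>N\<close> drops from
    \<open>m + 1\<close> to \<open>m\<close>.\<close>
  define \<rho> where "\<rho> = real m / (real m + 1)"
  have \<rho>: "0 < \<rho>" "\<rho> \<le> 1" using m by (auto simp: \<rho>_def)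
  have P: "real (\<Prod>i<n. N i) = (real m + 1) ^ n * \<rho> powr real (f n)" for n
  proof -
    have "real (\<Prod>i<n. N i) = (real m + 1) ^ n * \<rho> ^ f n"
    proof (induction n)
      case (Suc n)
      have \<rho>m: "real m = (real m + 1) * \<rho>" by (simp add: \<rho>_def)
      from fS[of n] show ?case
      proof
        assume "f (Suc n) = f n"
        then show ?thesis using Suc \<tau>[of n] by (simp add: N_def algebra_simps)
      next
        assume *: "f (Suc n) = Suc (f n)"
        then have "N n = m" using \<tau>[of n] by (simp add: N_def)
        then have "real (\<Prod>i<Suc n. N i) = (real m + 1) ^ n * \<rho> ^ f n * ((real m + 1) * \<rho>)"
          using Suc by (simp add: \<rho>m[symmetric])
        then show ?thesis using * by simp
      qed
    qed (simp add: f0)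
    then show ?thesis using \<rho> by (simp add: powr_realpow)
  qed
  \<comment> \<open>Compared with \<open>P\<close>, only the exponents \<open>f n\<close> and
    \<open>n * \<alpha>\<close> of \<open>\<rho>\<close> differ, by less than 1. This costs at most
    the constant factor \<open>1 / \<rho>\<close>.\<close>
  have qs: "q powr (real n * s) = (real m + 1) ^ n * \<rho> powr (real n * \<alpha>)" for n
  proof -
    have "\<alpha> * (ln (real m + 1) - ln (real m)) = ln (real m + 1) - s * ln q"
      using lnm by (simp add: \<alpha>_def)
    moreover have ln\<rho>: "ln \<rho> = - (ln (real m + 1) - ln (real m))"
      using m by (simp add: \<rho>_def ln_div)
    have "\<alpha> * ln \<rho> = - (\<alpha> * (ln (real m + 1) - ln (real m)))"
      unfolding ln\<rho> by (rule mult_minus_right)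
    ultimately have "s * ln q = ln (real m + 1) + \<alpha> * ln \<rho>" by linarith
    then have "real n * s * ln q = real n * ln (real m + 1) + real n * \<alpha> * ln \<rho>"
      by (metis mult.assoc distrib_left)
    then have "q powr (real n * s) = (real m + 1) powr real n * \<rho> powr (real n * \<alpha>)"
      using q1 \<rho> by (simp add: powr_def exp_add)
    then show ?thesis by (simp add: powr_realpow)
  qed
  have "hausdorff_dim (moran_set q lo N) \<le> ereal s"
  proof (rule hausdorff_dim_moran_le[OF qm loN s0])
    have "real (\<Prod>i<n. N i) \<le> 1 / \<rho> * q powr (real n * s)" for n
    proof -
      have "\<rho> powr real (f n) \<le> \<rho> powr (real n * \<alpha> - 1)"
        using \<rho> floor_seq_gt[OF \<alpha>(1), of n] by (intro powr_mono') (auto simp: f_def)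
      also have "\<dots> = 1 / \<rho> * \<rho> powr (real n * \<alpha>)" using \<rho> by (simp add: powr_diff)
      finally have "(real m + 1) ^ n * \<rho> powr real (f n) \<le> (real m + 1) ^ n * (1 / \<rho> * \<rho> powr (real n * \<alpha>))"
        by (intro mult_left_mono) auto
      then show ?thesis unfolding P qs by (simp add: mult_ac)
    qed
    then show "\<exists>\<^sub>F n in sequentially. real (\<Prod>i<n. N i) \<le> 1 / \<rho> * q powr (real n * s)"
      by (intro eventually_frequently always_eventually) auto
  qed
  moreover have "ereal s \<le> hausdorff_dim (moran_set q lo N)"
  proof (rule hausdorff_dim_moran_ge[OF qm loN zero_less_one])
    fix n
    have "\<rho> powr (real n * \<alpha>) \<le> \<rho> powr real (f n)"
      using \<rho> floor_seq_le[OF \<alpha>(1), of n] by (intro powr_mono') (auto simp: f_def)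
    then show "1 * q powr (real n * s) \<le> real (\<Prod>i<n. N i)"
      unfolding P qs by (simp add: mult_left_mono)
  qed
  ultimately have "ereal s = hausdorff_dim (Gamma_set q m \<inter> (\<lambda>x. x + t) ` Gamma_set q m)"
    unfolding eq by (intro antisym)
  then show ?thesis unfolding dim_set_def using tU by (intro CollectI exI[of _ t] conjI)
qed

subsection \<open>Below the critical base\<close>

lemma unique_exp_set_uminus:
  assumes "t \<in> unique_exp_set m q"
  shows "- t \<in> unique_exp_set m q"
proof -
  have neg: "is_expansion q (real_of_int ` {- int m..int m}) (\<lambda>i. - c i) (- x)"
    if "is_expansion q (real_of_int ` {- int m..int m}) c x" for c x
    unfolding is_expansion_def
  proof (intro conjI allI)
    fix i
    have "c i \<in> real_of_int ` {- int m..int m}" using that unfolding is_expansion_def by blast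
    then obtain z where "z \<in> {- int m..int m}" "c i = of_int z" by blast
    then show "- c i \<in> real_of_int ` {- int m..int m}" by (intro image_eqI[of _ _ "- z"]) auto
  next
    show "(\<lambda>i. - c i / q ^ Suc i) sums - x"
      using that sums_minus[of "\<lambda>i. c i / q ^ Suc i" x] by (simp add: is_expansion_def)
  qed
  obtain c where c: "is_expansion q (real_of_int ` {- int m..int m}) c t"
    and u: "\<And>c'. is_expansion q (real_of_int ` {- int m..int m}) c' t \<Longrightarrow> c' = c"
    using assms unfolding unique_exp_set_def by blast
  have "c' = (\<lambda>i. - c i)" if "is_expansion q (real_of_int ` {- int m..int m}) c' (- t)" for c'
    using u[of "\<lambda>i. - c' i"] neg[OF that] by auto
  then show ?thesis unfolding unique_exp_set_def using neg[OF c] by blast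
qed

section \<open>Restrictions on the digits of unique expansions\<close>

context
  fixes q :: real and m :: nat
  assumes q: "q > 1" "q \<le> 2 * real m + 1"
begin

text \<open>Otherwise \<open>y - 1\<close> would have modulus at most \<open>m / (q - 1)\<close> and
  hence an expansion. Raising digit \<open>k\<close> by one, which stays in the alphabet, and using
  that expansion as the new tail would expand \<open>t\<close> in a second way.\<close>

lemma unique_expansion_tail_less:
  fixes \<tau> :: "nat \<Rightarrow> int"
  assumes tU: "t \<in> unique_exp_set m q"
    and exp: "is_expansion q (real_of_int ` {- int m..int m}) (\<lambda>i. of_int (\<tau> i)) t"
    and k: "\<tau> k < int m"
    and y: "(\<lambda>i. of_int (\<tau> (i + Suc k)) / q ^ Suc i) sums y"
  shows "y + real m / (q - 1) < 1"
proof (rule ccontr)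
  assume large: "\<not> y + real m / (q - 1) < 1"
  have \<tau>: "\<bar>\<tau> i\<bar> \<le> int m" for i
    using exp by (auto simp: is_expansion_def dest!: spec[of _ i])
  then have "\<bar>real_of_int (\<tau> i)\<bar> \<le> real m" for i
    by (metis of_int_abs of_int_le_iff of_int_of_nat_eq)
  then have "\<bar>y\<bar> \<le> real m / (q - 1)" by (intro sums_digits_abs_le[OF q(1) _ y])
  then have "\<bar>y - 1\<bar> \<le> real m / (q - 1)" using large by linarith
  then obtain c where c: "is_expansion q (real_of_int ` {- int m..int m}) c (y - 1)"
    using ex_expansion[OF q] by blast
  define d where "d i = (if i < k then of_int (\<tau> i) else if i = k then of_int (\<tau> k + 1) else c (i - Suc k))" for i
  have "is_expansion q (real_of_int ` {- int m..int m}) d t"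
    unfolding is_expansion_def
  proof (intro conjI allI)
    fix i
    show "d i \<in> real_of_int ` {- int m..int m}"
      using \<tau>[of i] \<tau>[of k] k c by (auto simp: d_def is_expansion_def abs_le_iff intro!: imageI simp del: of_int_add)
  next
    have "(\<lambda>i. d (i + Suc k) / q ^ Suc i) sums (y - 1)"
      using c by (simp add: d_def is_expansion_def)
    then have 1: "(\<lambda>i. d i / q ^ Suc i) sums ((\<Sum>i<Suc k. d i / q ^ Suc i) + (y - 1) / q ^ Suc k)"
      by (subst (asm) sums_digits_shift[OF q(1)])
    have 2: "(\<lambda>i. of_int (\<tau> i) / q ^ Suc i) sums ((\<Sum>i<Suc k. of_int (\<tau> i) / q ^ Suc i) + y / q ^ Suc k)"
      using y by (subst (asm) sums_digits_shift[OF q(1), of "\<lambda>i. of_int (\<tau> i)"])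
    have "(\<Sum>i<Suc k. d i / q ^ Suc i) + (y - 1) / q ^ Suc k = (\<Sum>i<Suc k. of_int (\<tau> i) / q ^ Suc i) + y / q ^ Suc k"
      by (simp add: d_def add_divide_distrib diff_divide_distrib)
    also have "\<dots> = t" using 2 exp by (auto simp: is_expansion_def intro: sums_unique2)
    finally show "(\<lambda>i. d i / q ^ Suc i) sums t" using 1 by simp
  qed
  then have "d = (\<lambda>i. of_int (\<tau> i))"
    using tU exp unfolding unique_exp_set_def by blast
  then have "d k = of_int (\<tau> k)" by simp
  then show False by (simp add: d_def)
qed

context
  fixes L :: nat
  assumes L: "L \<ge> 1" "real m / (q - 1) / q ^ L \<le> 1 / q + real m / (q - 1) - 1"
begin

text \<open>The tail is at least \<open>1 / q\<close> from its first digit, minus at most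
  \<open>m / (q - 1) / q ^ L\<close> from the digits after the run. By the choice of
  \<open>L\<close> this is at least \<open>1 - m / (q - 1)\<close>, against
  \<open>unique_expansion_tail_less\<close>.\<close>

lemma unique_expansion_no_nonneg_run:
  fixes \<tau> :: "nat \<Rightarrow> int"
  assumes tU: "t \<in> unique_exp_set m q"
    and exp: "is_expansion q (real_of_int ` {- int m..int m}) (\<lambda>i. of_int (\<tau> i)) t"
    and k: "\<tau> k < int m" "\<tau> (Suc k) \<ge> 1" and nonneg: "\<And>i. i < L \<Longrightarrow> \<tau> (i + Suc k) \<ge> 0"
  shows False
proof -
  define a where "a i = real_of_int (\<tau> (i + Suc k))" for i
  obtain y where y: "(\<lambda>i. of_int (\<tau> (i + Suc k)) / q ^ Suc i) sums y"
    using sums_digits_tail[OF q(1), of "\<lambda>i. of_int (\<tau> i)" t "Suc k"] exp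
    unfolding is_expansion_def by blast
  then have "(\<lambda>i. a i / q ^ Suc i) sums y" by (simp add: a_def)
  then obtain w where w: "(\<lambda>i. a (i + L) / q ^ Suc i) sums w"
    "y = (\<Sum>i<L. a i / q ^ Suc i) + w / q ^ L"
    using sums_digits_tail[OF q(1), of a y L] by blast
  have "\<bar>\<tau> i\<bar> \<le> int m" for i
    using exp by (auto simp: is_expansion_def dest!: spec[of _ i])
  then have "\<bar>a i\<bar> \<le> real m" for i
    unfolding a_def by (metis of_int_abs of_int_le_iff of_int_of_nat_eq)
  then have "\<bar>w\<bar> \<le> real m / (q - 1)" by (intro sums_digits_abs_le[OF q(1) _ w(1)])
  then have "- (real m / (q - 1)) / q ^ L \<le> w / q ^ L"
    using q by (intro divide_right_mono) auto
  moreover have "1 / q \<le> (\<Sum>i<L. a i / q ^ Suc i)"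
  proof -
    have "1 / q \<le> a 0 / q ^ Suc 0" using k(2) q by (auto simp: a_def intro!: divide_right_mono)
    also have "\<dots> \<le> (\<Sum>i<L. a i / q ^ Suc i)"
      using L(1) nonneg q by (intro member_le_sum) (auto simp: a_def)
    finally show ?thesis .
  qed
  moreover have "y + real m / (q - 1) < 1"
    by (rule unique_expansion_tail_less[OF tU exp k(1) y])
  ultimately show False using L(2) w(2) by simp
qed

text \<open>Let \<open>l\<close> be the last place before \<open>j\<close> whose digit is below
  \<open>m\<close>. The digits after \<open>l\<close> are equal to \<open>m\<close> up to
  \<open>j\<close>, then positive at \<open>j\<close>; \<open>L\<close> zeros after that would
  complete a forbidden nonnegative run starting at \<open>l + 1\<close>.\<close>

lemma unique_expansion_gap_pos:
  fixes \<tau> :: "nat \<Rightarrow> int"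
  assumes tU: "t \<in> unique_exp_set m q"
    and exp: "is_expansion q (real_of_int ` {- int m..int m}) (\<lambda>i. of_int (\<tau> i)) t"
    and k: "\<tau> k < int m" "k < j" and j: "\<tau> j \<ge> 1"
  shows "\<exists>i. 0 < i \<and> i \<le> L \<and> \<tau> (j + i) \<noteq> 0"
proof (rule ccontr)
  assume "\<not> ?thesis"
  then have zero: "\<tau> (j + i) = 0" if "0 < i" "i \<le> L" for i using that by blast
  define l where "l = Max {i. i < j \<and> \<tau> i < int m}"
  have fin: "finite {i. i < j \<and> \<tau> i < int m}" by simp
  have "l \<in> {i. i < j \<and> \<tau> i < int m}" unfolding l_def using k by (intro Max_in) auto
  then have l: "l < j" "\<tau> l < int m" by auto
  have "\<tau> i \<le> int m" for i
    using exp by (auto simp: is_expansion_def dest!: spec[of _ i])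
  moreover have "\<not> \<tau> i < int m" if "l < i" "i < j" for i
  proof
    assume "\<tau> i < int m"
    then have "i \<le> l" unfolding l_def using that by (intro Max_ge[OF fin]) simp
    then show False using that by simp
  qed
  ultimately have max: "\<tau> i = int m" if "l < i" "i < j" for i
    using that by (metis order_le_less)
  have m1: "int m \<ge> 1" using j \<open>\<And>i. \<tau> i \<le> int m\<close>[of j] by simp
  have *: "\<tau> i \<ge> 1" if "l < i" "i \<le> j" for i
    using max[of i] j m1 that by (cases "i = j") auto
  have "\<tau> (i + Suc l) \<ge> 0" if "i < L" for i
  proof (cases "i + Suc l \<le> j")
    case True
    then show ?thesis using *[of "i + Suc l"] by simp
  next
    case False
    then show ?thesis using zero[of "i + Suc l - j"] that l by simp
  qed
  then show False
    using unique_expansion_no_nonneg_run[OF tU exp l(2)] *[of "Suc l"] l by auto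
qed

lemma unique_expansion_gap:
  fixes \<tau> :: "nat \<Rightarrow> int"
  assumes m: "m \<ge> 1" and tU: "t \<in> unique_exp_set m q"
    and exp: "is_expansion q (real_of_int ` {- int m..int m}) (\<lambda>i. of_int (\<tau> i)) t"
    and k: "\<tau> k = 0" "k < j" and j: "\<tau> j \<noteq> 0"
  shows "\<exists>i. 0 < i \<and> i \<le> L \<and> \<tau> (j + i) \<noteq> 0"
proof (cases "\<tau> j \<ge> 1")
  case True
  then show ?thesis using unique_expansion_gap_pos[OF tU exp _ k(2)] k m by auto
next
  case False
  \<comment> \<open>Negating \<open>t\<close> and all digits preserves uniqueness and makes digit
    \<open>j\<close> positive.\<close>
  have "\<tau> i \<in> {- int m..int m}" for i
    using exp by (auto simp: is_expansion_def dest!: spec[of _ i])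
  then have "real_of_int (- \<tau> i) \<in> real_of_int ` {- int m..int m}" for i
    by (intro imageI) (metis atLeastAtMost_iff minus_le_iff neg_le_iff_le)
  then have "is_expansion q (real_of_int ` {- int m..int m}) (\<lambda>i. of_int (- \<tau> i)) (- t)"
    using exp sums_minus[of "\<lambda>i. of_int (\<tau> i) / q ^ Suc i" t] by (simp add: is_expansion_def)
  then have "\<exists>i. 0 < i \<and> i \<le> L \<and> - \<tau> (j + i) \<noteq> 0"
    using unique_expansion_gap_pos[OF unique_exp_set_uminus[OF tU], of "\<lambda>i. - \<tau> i" k j] k m j False
    by auto
  then show ?thesis by auto
qed

text \<open>Once a nonzero digit follows a zero, the last nonzero place up to any later
  \<open>n\<close> has a successor within \<open>L\<close>, necessarily beyond \<open>n\<close>. If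
  no zero is followed by a nonzero digit, either the sequence ends in zeros or it has none.\<close>

lemma unique_expansion_zero_or_syndetic:
  fixes \<tau> :: "nat \<Rightarrow> int"
  assumes m: "m \<ge> 1" and tU: "t \<in> unique_exp_set m q"
    and exp: "is_expansion q (real_of_int ` {- int m..int m}) (\<lambda>i. of_int (\<tau> i)) t"
  shows "(\<exists>j. \<forall>n\<ge>j. \<tau> n = 0) \<or> (\<exists>j. \<forall>n\<ge>j. \<exists>i\<le>L. \<tau> (n + i) \<noteq> 0)"
proof (cases "\<exists>k. \<tau> k = 0 \<and> (\<exists>j>k. \<tau> j \<noteq> 0)")
  case True
  then obtain k j where kj: "\<tau> k = 0" "k < j" "\<tau> j \<noteq> 0" by blast
  have "\<exists>i\<le>L. \<tau> (n + i) \<noteq> 0" if n: "n \<ge> j" for n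
  proof -
    define l where "l = Max {i. i \<le> n \<and> \<tau> i \<noteq> 0}"
    have fin: "finite {i. i \<le> n \<and> \<tau> i \<noteq> 0}" by simp
    have "l \<in> {i. i \<le> n \<and> \<tau> i \<noteq> 0}" unfolding l_def using kj n by (intro Max_in) auto
    then have l: "l \<le> n" "\<tau> l \<noteq> 0" by auto
    have "j \<le> l" unfolding l_def using kj n by (intro Max_ge) auto
    then obtain i where i: "0 < i" "i \<le> L" "\<tau> (l + i) \<noteq> 0"
      using unique_expansion_gap[OF m tU exp kj(1) _ l(2)] kj(2) by auto
    have "\<not> l + i \<le> n" using Max_ge[OF fin, of "l + i"] i unfolding l_def by auto
    then show ?thesis using i l by (intro exI[of _ "l + i - n"]) auto
  qed
  then show ?thesis by blast
next
  case False
  show ?thesis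
  proof (cases "\<exists>k. \<tau> k = 0")
    case True
    then obtain k where "\<tau> k = 0" by blast
    then have "\<tau> n = 0" if "n \<ge> k" for n using False that by (metis order_le_less)
    then show ?thesis by blast
  next
    case False
    then show ?thesis by blast
  qed
qed

end

end

section \<open>Window products and the dimension gap\<close>

lemma prod_window_le:
  fixes a :: "nat \<Rightarrow> nat"
  assumes "\<And>i. a i \<le> Suc m" "i \<le> L" "a i \<le> m"
  shows "(\<Prod>i<Suc L. a i) \<le> Suc m ^ L * m"
proof -
  have "(\<Prod>i<Suc L. a i) = a i * prod a ({..<Suc L} - {i})"
    using assms by (intro prod.remove) auto
  also have "\<dots> \<le> m * (\<Prod>i\<in>{..<Suc L} - {i}. Suc m)"
    using assms by (intro mult_mono prod_mono) auto
  also have "\<dots> = Suc m ^ L * m" using assms by simp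
  finally show ?thesis .
qed

lemma prod_lessThan_add:
  fixes a :: "nat \<Rightarrow> 'a::comm_monoid_mult"
  shows "(\<Prod>i<n + k. a i) = (\<Prod>i<n. a i) * (\<Prod>i<k. a (n + i))"
  by (induction k) (auto simp: mult_ac)

lemma dim_set_gap:
  assumes m: "m \<ge> 1" and q: "real m + 1 < q" "q < q_crit m"
  shows "\<exists>\<delta>>0. dim_set m q \<inter>
           {ereal (ln (real m + 1) / ln q - \<delta>) <..< ereal (ln (real m + 1) / ln q)} = {}"
proof -
  have q1: "q > 1" using q by simp
  \<comment> \<open>Here \<open>m + 2 <= 2 * m + 1\<close>, so \<open>ex_expansion\<close> is
    available.\<close>
  have q2: "q \<le> 2 * real m + 1" using q q_crit_less[of m] m by simp
  have lnq: "ln q > 0" using q1 by simp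
  have lnm: "ln (real m) < ln (real m + 1)" using m by simp
  have "1 / q + real m / (q - 1) > 1" using q_crit_le_iff[OF m q(1)] q(2) by auto
  then have pos: "1 / q + real m / (q - 1) - 1 > 0" by simp
  have "(\<lambda>n. real m / (q - 1) * (1 / q) ^ n) \<longlonglongrightarrow> 0"
    using q1 by (intro tendsto_mult_right_zero LIMSEQ_power_zero) auto
  then have "\<forall>\<^sub>F n in sequentially. real m / (q - 1) * (1 / q) ^ n < 1 / q + real m / (q - 1) - 1"
    using pos by (rule order_tendstoD)
  \<comment> \<open>\<open>L\<close> depends on \<open>q\<close> and \<open>m\<close> only, which
    makes the gap uniform in \<open>t\<close>.\<close>
  from eventually_conj[OF this eventually_ge_at_top[of 1]]
  obtain L where L: "L \<ge> 1" "real m / (q - 1) * (1 / q) ^ L < 1 / q + real m / (q - 1) - 1"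
    by (auto simp: eventually_sequentially)
  then have L': "real m / (q - 1) / q ^ L \<le> 1 / q + real m / (q - 1) - 1"
    by (simp add: power_divide)
  \<comment> \<open>Chosen so that \<open>q powr ((L + 1) * s) = (m + 1) ^ L * m\<close>, the
    largest branching over a window of \<open>L + 1\<close> places with a nonzero digit.\<close>
  define \<delta> where "\<delta> = (ln (real m + 1) - ln (real m)) / (real (Suc L) * ln q)"
  define s where "s = ln (real m + 1) / ln q - \<delta>"
  have \<delta>: "\<delta> > 0" using lnm lnq by (simp add: \<delta>_def)
  have sL: "real (Suc L) * s * ln q = real L * ln (real m + 1) + ln (real m)"
  proof -
    have "\<delta> * (real (Suc L) * ln q) = ln (real m + 1) - ln (real m)"
      using lnq by (simp add: \<delta>_def)
    moreover have "s * ln q = ln (real m + 1) - \<delta> * ln q"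
      using lnq by (simp add: s_def left_diff_distrib)
    then have "real (Suc L) * s * ln q = real (Suc L) * ln (real m + 1) - \<delta> * (real (Suc L) * ln q)"
      by (simp only: mult.assoc right_diff_distrib mult.left_commute)
    ultimately show ?thesis by (simp add: algebra_simps)
  qed
  have s0: "s \<ge> 0"
  proof -
    have "0 \<le> real L * ln (real m + 1) + ln (real m)" using m by simp
    then have "0 \<le> s * (real (Suc L) * ln q)" unfolding sL[symmetric] by (simp add: mult_ac)
    moreover have "real (Suc L) * ln q > 0" using lnq by simp
    ultimately show ?thesis by (simp add: zero_le_mult_iff)
  qed
  have step: "real (Suc m ^ L * m) = q powr (real (Suc L) * s)"
  proof -
    have "q powr (real (Suc L) * s) = exp (real L * ln (real m + 1) + ln (real m))"
      unfolding powr_def sL[symmetric] using q1 by simp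
    also have "\<dots> = (real m + 1) powr real L * real m"
      using m by (simp add: exp_add powr_def)
    finally show ?thesis by (simp add: powr_realpow add.commute)
  qed
  have top: "q powr (real n * (ln (real m + 1) / ln q)) = (real m + 1) ^ n" for n
  proof -
    have "q powr (real n * (ln (real m + 1) / ln q)) = (real m + 1) powr real n"
      using lnq q1 by (simp add: powr_def)
    then show ?thesis by (simp add: powr_realpow)
  qed
  have "hausdorff_dim (Gamma_set q m \<inter> (\<lambda>x. x + t) ` Gamma_set q m) \<le> ereal s \<or>
        ereal (ln (real m + 1) / ln q) \<le> hausdorff_dim (Gamma_set q m \<inter> (\<lambda>x. x + t) ` Gamma_set q m)"
    if tU: "t \<in> unique_exp_set m q" for t
  proof -
    obtain c where c: "is_expansion q (real_of_int ` {- int m..int m}) c t"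
      using tU unfolding unique_exp_set_def by blast
    then have "\<forall>i. \<exists>z. \<bar>z\<bar> \<le> int m \<and> c i = of_int z"
      unfolding is_expansion_def by (fastforce simp: abs_le_iff)
    then obtain \<tau> where \<tau>: "\<And>i. \<bar>\<tau> i\<bar> \<le> int m" "c = (\<lambda>i. of_int (\<tau> i))" by metis
    note exp = c[unfolded \<tau>(2)]
    define N where "N i = Suc m - nat \<bar>\<tau> i\<bar>" for i
    define lo where "lo i = nat (\<tau> i)" for i
    have eq: "Gamma_set q m \<inter> (\<lambda>x. x + t) ` Gamma_set q m = moran_set q lo N"
      unfolding N_def lo_def by (rule moran_set_eq_Inter[OF \<tau>(1) exp tU])
    have loN: "lo i + N i \<le> Suc m" "N i \<ge> 1" for i
      using \<tau>(1)[of i] by (auto simp: lo_def N_def)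
    have N_le: "N i \<le> Suc m" for i by (simp add: N_def)
    consider j where "\<forall>n\<ge>j. \<tau> n = 0" | j where "\<forall>n\<ge>j. \<exists>i\<le>L. \<tau> (n + i) \<noteq> 0"
      using unique_expansion_zero_or_syndetic[OF q1 q2 L(1) L' m tU exp] by blast
    then show ?thesis
    proof cases
      case 1
      \<comment> \<open>The constant \<open>(m + 1) ^ j\<close> absorbs the first \<open>j\<close>
        places; beyond them every factor is \<open>m + 1\<close>.\<close>
      have small: "(real m + 1) ^ n \<le> (real m + 1) ^ j * real (\<Prod>i<n. N i)" if "n \<le> j" for n
      proof -
        have "(\<Prod>i<n. N i) \<ge> 1" using loN(2) by (intro prod_ge_1) auto
        then have "1 \<le> real (\<Prod>i<n. N i)" by linarith
        then have "(real m + 1) ^ n * 1 \<le> (real m + 1) ^ j * real (\<Prod>i<n. N i)"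
          using that by (intro mult_mono power_increasing) auto
        then show ?thesis by simp
      qed
      have "(real m + 1) ^ n \<le> (real m + 1) ^ j * real (\<Prod>i<n. N i)" for n
      proof (cases "n \<le> j")
        case False
        then have "j \<le> n" by simp
        then show ?thesis
        proof (induction n rule: dec_induct)
          case base
          show ?case by (rule small) simp
        next
          case (step n)
          then have "N n = Suc m" using 1 by (simp add: N_def)
          then show ?case
            using mult_right_mono[OF step.IH, of "real m + 1"] by (simp add: algebra_simps)
        qed
      qed (rule small)
      then have "1 / (real m + 1) ^ j * q powr (real n * (ln (real m + 1) / ln q)) \<le> real (\<Prod>i<n. N i)" for n
        unfolding top by (simp add: field_simps)
      then have "ereal (ln (real m + 1) / ln q) \<le> hausdorff_dim (moran_set q lo N)"
        by (intro hausdorff_dim_moran_ge[OF q(1) loN, where c = "1 / (real m + 1) ^ j"]) auto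
      then show ?thesis unfolding eq by simp
    next
      case 2
      \<comment> \<open>After the first \<open>j\<close> places the digits are cut into
        \<open>k\<close> windows of length \<open>L + 1\<close>, each containing a nonzero
        digit.\<close>
      have P: "real (\<Prod>i<j + k * Suc L. N i) \<le> real (Suc m) ^ j * q powr (real (k * Suc L) * s)" for k
      proof (induction k)
        case 0
        have "(\<Prod>i<j. N i) \<le> (\<Prod>i<j. Suc m)" using N_le by (intro prod_mono) auto
        then have "real (\<Prod>i<j. N i) \<le> real (Suc m ^ j)" by (subst of_nat_le_iff) simp
        then show ?case using q1 by simp
      next
        case (Suc k)
        obtain i where i: "i \<le> L" "\<tau> (j + k * Suc L + i) \<noteq> 0" using 2 le_add1 by blast
        then have "(\<Prod>i<Suc L. N (j + k * Suc L + i)) \<le> Suc m ^ L * m"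
          using N_le by (intro prod_window_le[of _ _ i]) (auto simp: N_def)
        then have "real (\<Prod>i<Suc L. N (j + k * Suc L + i)) \<le> q powr (real (Suc L) * s)"
          unfolding step[symmetric] of_nat_le_iff .
        then have "real (\<Prod>i<j + k * Suc L. N i) * real (\<Prod>i<Suc L. N (j + k * Suc L + i))
             \<le> real (Suc m) ^ j * q powr (real (k * Suc L) * s) * q powr (real (Suc L) * s)"
          by (intro mult_mono[OF Suc.IH _ _ of_nat_0_le_iff]) auto
        also have "\<dots> = real (Suc m) ^ j * q powr (real (k * Suc L) * s + real (Suc L) * s)"
          by (simp only: powr_add mult.assoc)
        also have "real (k * Suc L) * s + real (Suc L) * s = real (Suc k * Suc L) * s"
          by (simp add: algebra_simps)
        finally have "real (\<Prod>i<j + k * Suc L. N i) * real (\<Prod>i<Suc L. N (j + k * Suc L + i))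
             \<le> real (Suc m) ^ j * q powr (real (Suc k * Suc L) * s)" .
        moreover have "j + Suc k * Suc L = j + k * Suc L + Suc L" by simp
        ultimately show ?case
          by (simp only: prod_lessThan_add[of N "j + k * Suc L" "Suc L"] of_nat_mult[of "\<Prod>i<j + k * Suc L. N i"])
      qed
      \<comment> \<open>The lengths that end at a window boundary are infinitely many, which is
        enough for the upper bound.\<close>
      have "\<exists>\<^sub>F n in sequentially. real (\<Prod>i<n. N i) \<le> real (Suc m) ^ j * q powr (real n * s)"
        unfolding frequently_sequentially
      proof (intro allI exI conjI)
        fix k
        show "k \<le> j + k * Suc L" by simp
        have "real (k * Suc L) * s \<le> real (j + k * Suc L) * s" using s0 by (intro mult_right_mono) auto
        then have "q powr (real (k * Suc L) * s) \<le> q powr (real (j + k * Suc L) * s)"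
          using q1 by (intro powr_mono) auto
        then show "real (\<Prod>i<j + k * Suc L. N i) \<le> real (Suc m) ^ j * q powr (real (j + k * Suc L) * s)"
          by (intro order_trans[OF P] mult_left_mono) auto
      qed
      then have "hausdorff_dim (moran_set q lo N) \<le> ereal s"
        by (rule hausdorff_dim_moran_le[OF q(1) loN s0])
      then show ?thesis unfolding eq by simp
    qed
  qed
  \<comment> \<open>The forbidden interval is open at its upper end, so in the zero-tail case a
    lower bound suffices.\<close>
  then have "dim_set m q \<inter> {ereal s <..< ereal (ln (real m + 1) / ln q)} = {}"
    unfolding dim_set_def by force
  then show ?thesis using \<delta> unfolding s_def by blast
qed

theorem theorem1p5:
  fixes m :: nat
  assumes "m \<ge> 1"
  shows "(\<forall>q::real. q \<ge> q_crit m \<longrightarrow>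
            {ereal (ln (real m) / ln q) .. ereal (ln (real m + 1) / ln q)} \<subseteq> dim_set m q) \<and>
         (\<forall>q::real. real m + 1 < q \<and> q < q_crit m \<longrightarrow>
            (\<exists>\<delta>>0. dim_set m q \<inter>
               {ereal (ln (real m + 1) / ln q - \<delta>) <..< ereal (ln (real m + 1) / ln q)} = {}))"
proof (intro conjI allI impI subsetI)
  fix q :: real and x
  assume q: "q_crit m \<le> q" and x: "x \<in> {ereal (ln (real m) / ln q)..ereal (ln (real m + 1) / ln q)}"
  then obtain s where "x = ereal s" by (cases x) auto
  then show "x \<in> dim_set m q" using interval_subset_dim_set[OF assms q] x by simp
next
  fix q :: real
  assume "real m + 1 < q \<and> q < q_crit m"
  then show "\<exists>\<delta>>0. dim_set m q \<inter>
      {ereal (ln (real m + 1) / ln q - \<delta>) <..< ereal (ln (real m + 1) / ln q)} = {}"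
    using dim_set_gap[OF assms] by blast
qed

end
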